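(* For every $k \in \mathbb{N} = \{1,2,\dots\}$ with $S_2(k) = \mathrm{nM}_1(k)$ it holds that $$S_2(k) = \mathrm{FCH}(k) = \mathrm{FCM}(k) = \mathrm{VDH}(k) = \mathrm{VDM}(k) = \mathrm{nM}_1(k).$$
   Context: Clause-sets. There is an infinite set of variables (containing $\mathbb{N}$); literals are variables $v$ and their complements $\overline{v}$, with $\overline{\overline{x}} = x$. A clause is a finite set of literals not containing a complementary pair $x, \overline{x}$; a clause-set is a finite set of clauses. $\mathrm{var}(C)$ is the set of underlying variables of the literals of the clause $C$, and $\mathrm{var}(F) = \bigcup_{C \in F} \mathrm{var}(C)$. Put $n(F) = |\mathrm{var}(F)|$, $c(F) = |F|$, and deficiency $\delta(F) = c(F) - n(F)$. $F$ is satisfiable if there is a clause $C$ with $C \cap D \neq \emptyset$ for all $D \in F$, otherwise unsatisfiable. $\mathcal{MU}$ is the set of minimally unsatisfiable clause-sets: $F$ unsatisfiable with every proper subset of $F$ satisfiable. $\mathcal{UHIT}$ is the set of unsatisfiable hitting clause-sets: $F$ unsatisfiable such that for all $C, D \in F$ with $C \ne D$ there is $x \in C$ with $\overline{x} \in D$. A full clause of $F$ is $C \in F$ with $\mathrm{var}(C) = \mathrm{var}(F)$; $\mathrm{fc}(F)$ is the number of full clauses of $F$. For $\mathrm{var}(F) \ne \emptyset$ the min-var-degree is $\mu\mathrm{vd}(F) = \min_{v \in \mathrm{var}(F)} |\{C \in F : v \in \mathrm{var}(C)\}|$. The four fundamental quantities. For $k \in \mathbb{N}$: $\mathrm{FCH}(k)$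 is the maximum of $\mathrm{fc}(F)$ over $F \in \mathcal{UHIT}$ with $\delta(F) = k$; $\mathrm{FCM}(k)$ is the maximum of $\mathrm{fc}(F)$ over $F \in \mathcal{MU}$ with $\delta(F) = k$; $\mathrm{VDH}(k)$ is the maximum of $\mu\mathrm{vd}(F)$ over $F \in \mathcal{UHIT}$ with $\delta(F) = k$; $\mathrm{VDM}(k)$ is the maximum of $\mu\mathrm{vd}(F)$ over $F \in \mathcal{MU}$ with $\delta(F) = k$. For $k = 1$ the clause-set $\{\emptyset\}$ (containing only the empty clause) is excluded in the definitions of $\mathrm{VDH}$ and $\mathrm{VDM}$. Number sequences. $S_2(k)$, for $k \ge 1$, is the smallest integer $n \ge 0$ such that $2^k$ divides $n!$. $\mathrm{nM} : \mathbb{N} \to \mathbb{N}$ is the strictly increasing enumeration of the natural numbers $\ge 1$ not of the form $2^n - 1$, $n \in \mathbb{N}$. $\mathrm{nM}_1 : \mathbb{N} \to \mathbb{N}$ is defined by $\mathrm{nM}_1(2^n - n + 1) := \mathrm{nM}(2^n - n + 1) - 1 = 2^n$ for $n \ge 3$, and $\mathrm{nM}_1(k) := \mathrm{nM}(k)$ for all $k$ not of the form $2^n - n + 1$ with $n \ge 3$. *)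

theory Defs
  imports Complex_Main "HOL-Library.Infinite_Set" "HOL-Library.Infinite_Typeclass"
begin

section \<open>Clause-sets\<close>

datatype 'v literal = Pos 'v | Neg 'v

fun complement :: "'v literal \<Rightarrow> 'v literal" where
  "complement (Pos v) = Neg v"
| "complement (Neg v) = Pos v"

fun lit_var :: "'v literal \<Rightarrow> 'v" where
  "lit_var (Pos v) = v"
| "lit_var (Neg v) = v"

definition is_clause :: "'v literal set \<Rightarrow> bool" where
  "is_clause C \<longleftrightarrow> finite C \<and> (\<forall>x\<in>C. complement x \<notin> C)"

definition is_clause_set :: "'v literal set set \<Rightarrow> bool" where
  "is_clause_set F \<longleftrightarrow> finite F \<and> (\<forall>C\<in>F. is_clause C)"

definition clause_vars :: "'v literal set \<Rightarrow> 'v set" where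
  "clause_vars C = lit_var ` C"

definition cs_vars :: "'v literal set set \<Rightarrow> 'v set" where
  "cs_vars F = (\<Union>C\<in>F. clause_vars C)"

definition num_vars :: "'v literal set set \<Rightarrow> nat" where
  "num_vars F = card (cs_vars F)"

definition num_clauses :: "'v literal set set \<Rightarrow> nat" where
  "num_clauses F = card F"

definition deficiency :: "'v literal set set \<Rightarrow> int" where
  "deficiency F = int (num_clauses F) - int (num_vars F)"

definition satisfiable :: "'v literal set set \<Rightarrow> bool" where
  "satisfiable F \<longleftrightarrow> (\<exists>C. is_clause C \<and> (\<forall>D\<in>F. C \<inter> D \<noteq> {}))"

definition MU :: "'v literal set set set" where
  "MU = {F. is_clause_set F \<and> \<not> satisfiable F \<and> (\<forall>G. G \<subset> F \<longrightarrow> satisfiable G)}"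

definition UHIT :: "'v literal set set set" where
  "UHIT = {F. is_clause_set F \<and> \<not> satisfiable F \<and>
              (\<forall>C\<in>F. \<forall>D\<in>F. C \<noteq> D \<longrightarrow> (\<exists>x\<in>C. complement x \<in> D))}"

definition fc :: "'v literal set set \<Rightarrow> nat" where
  "fc F = card {C \<in> F. clause_vars C = cs_vars F}"

definition var_degree :: "'v literal set set \<Rightarrow> 'v \<Rightarrow> nat" where
  "var_degree F v = card {C \<in> F. v \<in> clause_vars C}"

text \<open>Only meaningful if \<^term>\<open>cs_vars F \<noteq> {}\<close>.\<close>

definition min_var_degree :: "'v literal set set \<Rightarrow> nat" where
  "min_var_degree F = Min (var_degree F ` cs_vars F)"

section \<open>The four fundamental quantities\<close>

text \<open>
  The infinite set of variables is an arbitrary type of class \<^class>\<open>infinite\<close>;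
  since that type cannot be read off from the value, it is passed as a type argument.
  The value of \<^const>\<open>Max\<close> is unspecified for empty and for infinite sets, so that an
  equation between one of these quantities and a concrete number
  is a claim about a maximum that exists.
  The clause-set \<open>{{}}\<close> (deficiency 1, no variables) has no min-var-degree; it is the only
  element of \<^const>\<open>MU\<close> or \<^const>\<open>UHIT\<close> without variables, and it is excluded from
  \<open>VDH\<close> and \<open>VDM\<close> (for deficiency other than 1 the exclusion is vacuous).
\<close>

definition FCH :: "'v::infinite itself \<Rightarrow> nat \<Rightarrow> nat" where
  "FCH V k = Max {fc F | F :: 'v literal set set. F \<in> UHIT \<and> deficiency F = int k}"

definition FCM :: "'v::infinite itself \<Rightarrow> nat \<Rightarrow> nat" where
  "FCM V k = Max {fc F | F :: 'v literal set set. F \<in> MU \<and> deficiency F = int k}"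

definition VDH :: "'v::infinite itself \<Rightarrow> nat \<Rightarrow> nat" where
  "VDH V k = Max {min_var_degree F | F :: 'v literal set set.
                    F \<in> UHIT \<and> deficiency F = int k \<and> F \<noteq> {{}}}"

definition VDM :: "'v::infinite itself \<Rightarrow> nat \<Rightarrow> nat" where
  "VDM V k = Max {min_var_degree F | F :: 'v literal set set.
                    F \<in> MU \<and> deficiency F = int k \<and> F \<noteq> {{}}}"

section \<open>Number sequences\<close>

definition S2 :: "nat \<Rightarrow> nat" where
  "S2 k = (LEAST n. (2::nat) ^ k dvd fact n)"

text \<open>
  All sequences are indexed from 1, whereas \<^const>\<open>enumerate\<close> counts from 0.
  So \<open>nM\<close> starts with \<open>nM 1 = 2\<close>, \<open>nM 2 = 4\<close>, \<open>nM 3 = 5\<close>, \<open>nM 4 = 6\<close>, \<open>nM 5 = 8\<close>.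
\<close>

definition nM :: "nat \<Rightarrow> nat" where
  "nM k = enumerate {m. m \<ge> 1 \<and> \<not> (\<exists>n\<ge>1. m = 2 ^ n - 1)} (k - 1)"

text \<open>
  At the exceptional positions \<open>k = 2 ^ n - n + 1\<close> one has \<open>nM k = 2 ^ n + 1\<close>,
  so the value there is \<open>2 ^ n\<close>.
\<close>

definition nM1 :: "nat \<Rightarrow> nat" where
  "nM1 k = (if \<exists>n\<ge>3. k = 2 ^ n - n + 1 then nM k - 1 else nM k)"

end

theory Submission
  imports Defs
begin


text \<open>
  Always \<open>FCH \<le> FCM, VDH \<le> VDM\<close>, so it suffices to prove \<open>S2 k \<le> FCH k\<close> and \<open>VDM k \<le> nM1 k\<close>.

  Lower bound: replacing \<open>h\<close> full clauses \<open>C\<close> by \<open>C \<union> {v}\<close> and \<open>C \<union> {\<not>v}\<close> for one fresh variable \<open>v\<close>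
  raises the deficiency by \<open>h - 1\<close> and leaves \<open>2h\<close> full clauses. Since \<open>v\<^sub>2((2h)!) = h + v\<^sub>2(h!)\<close>, this
  is exactly the recursion satisfied by \<open>S2\<close>.

  Upper bound: saturate a minimally unsatisfiable \<open>F\<close> and set a literal of a variable of minimum
  degree to true; the result is minimally unsatisfiable and loses only that variable, so that by
  induction a minimum degree \<open>d\<close> forces deficiency at least \<open>d - \<lfloor>log 2 d\<rfloor>\<close>, which is the bound \<open>nM\<close>.
  At \<open>k = 2^n - n + 1\<close> the same induction excludes the value \<open>2^n + 1\<close> once it is excluded
  for \<open>n = 3\<close>, that is, for deficiency 6 and minimum degree 9. There the literals of a variable of degree 9
  occur 5 and 4 times. Setting the more frequent one to true gives deficiency 2 and degrees at
  least 4, where absence of unit clauses forces every literal to occur exactly twice; this makes every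
  clause through a literal occurring 5 times full, which leads to a contradiction by counting full clauses.
\<close>

section \<open>Assignments and minimal unsatisfiability\<close>

text \<open>Setting a literal in a minimally unsatisfiable clause-set can make other clauses
  redundant. In a saturated one every clause is the only one falsified by some assignment with a
  prescribed value at any variable outside it, and this preserves minimality. Minimum degree then
  prevents a second variable from disappearing together with the assigned one, so deficiencies can
  be computed exactly. The sharper bound cannot start its induction at \<open>n = 2\<close>:
  \<open>nM1 3 = nM 3 = 5 = 2 ^ 2 + 1\<close>, so nothing is excluded there. Deficiency 6 is the
  first exceptional position and needs an argument of its own. Unit clauses are the obstacle in it,
  since the claim that every literal occurs exactly twice fails in their presence; they are
  propagated away at the start and must be shown not to reappear after the split.\<close>

fun lit_true :: "('v \<Rightarrow> bool) \<Rightarrow> 'v literal \<Rightarrow> bool" where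
  "lit_true \<phi> (Pos v) = \<phi> v"
| "lit_true \<phi> (Neg v) = (\<not> \<phi> v)"

definition models :: "('v \<Rightarrow> bool) \<Rightarrow> 'v literal set set \<Rightarrow> bool" where
  "models \<phi> F \<longleftrightarrow> (\<forall>C\<in>F. \<exists>x\<in>C. lit_true \<phi> x)"

lemma complement_complement [simp]: "complement (complement x) = x"
  by (cases x) auto

lemma complement_neq [simp]: "complement x \<noteq> x" "x \<noteq> complement x"
  by (cases x; simp)+

lemma complement_inject [simp]: "complement x = complement y \<longleftrightarrow> x = y"
  by (metis complement_complement)

lemma lit_var_complement [simp]: "lit_var (complement x) = lit_var x"
  by (cases x) auto

lemma lit_true_complement [simp]: "lit_true \<phi> (complement x) \<longleftrightarrow> \<not> lit_true \<phi> x"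
  by (cases x) auto

lemma lit_var_eq_iff: "lit_var x = lit_var y \<longleftrightarrow> x = y \<or> x = complement y"
  by (cases x; cases y) auto

lemma lit_true_upd_other: "lit_var x \<noteq> v \<Longrightarrow> lit_true (\<phi>(v := b)) x = lit_true \<phi> x"
  by (cases x) auto

definition set_true :: "'v literal \<Rightarrow> ('v \<Rightarrow> bool) \<Rightarrow> 'v \<Rightarrow> bool" where
  "set_true l \<phi> = \<phi>(lit_var l := (l = Pos (lit_var l)))"

lemma set_true_self [simp]: "lit_true (set_true l \<phi>) l"
  by (cases l) (auto simp: set_true_def)

lemma set_true_other: "lit_var x \<noteq> lit_var l \<Longrightarrow> lit_true (set_true l \<phi>) x = lit_true \<phi> x"
  by (simp add: set_true_def lit_true_upd_other)

lemma set_true_mono: "lit_true \<phi> x \<Longrightarrow> x \<noteq> complement l \<Longrightarrow> lit_true (set_true l \<phi>) x"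
  by (metis set_true_other set_true_self lit_var_eq_iff)

lemma clause_setD:
  assumes "is_clause_set F"
  shows "finite F" "C \<in> F \<Longrightarrow> finite C" "C \<in> F \<Longrightarrow> x \<in> C \<Longrightarrow> complement x \<notin> C"
  using assms by (auto simp: is_clause_set_def is_clause_def)

lemma finite_cs_vars: "is_clause_set F \<Longrightarrow> finite (cs_vars F)"
  by (auto simp: cs_vars_def clause_vars_def is_clause_set_def is_clause_def)

lemma is_clause_set_subset: "is_clause_set F \<Longrightarrow> G \<subseteq> F \<Longrightarrow> is_clause_set G"
  by (auto simp: is_clause_set_def intro: finite_subset)

lemma satisfiable_iff_models:
  assumes "is_clause_set F"
  shows "satisfiable F \<longleftrightarrow> (\<exists>\<phi>. models \<phi> F)"
proof
  assume "satisfiable F"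
  then obtain C where C: "is_clause C" "\<forall>D\<in>F. C \<inter> D \<noteq> {}"
    by (auto simp: satisfiable_def)
  have "lit_true (\<lambda>v. Pos v \<in> C) x" if "x \<in> C" for x
    using that C(1) by (cases x) (auto simp: is_clause_def)
  then have "models (\<lambda>v. Pos v \<in> C) F"
    using C(2) by (force simp: models_def)
  then show "\<exists>\<phi>. models \<phi> F" by blast
next
  assume "\<exists>\<phi>. models \<phi> F"
  then obtain \<phi> where \<phi>: "models \<phi> F" ..
  \<comment> \<open>Only literals occurring in \<open>F\<close> are taken, since the set of all true
    literals may be infinite and a clause is finite.\<close>
  let ?C = "{x \<in> \<Union>F. lit_true \<phi> x}"
  have "is_clause ?C"
    using assms by (auto simp: is_clause_def is_clause_set_def)
  moreover have "\<forall>D\<in>F. ?C \<inter> D \<noteq> {}"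
    using \<phi> by (fastforce simp: models_def)
  ultimately show "satisfiable F"
    by (auto simp: satisfiable_def)
qed

lemma models_mono: "models \<phi> F \<Longrightarrow> G \<subseteq> F \<Longrightarrow> models \<phi> G"
  by (auto simp: models_def)

lemma MU_iff:
  "F \<in> MU \<longleftrightarrow> is_clause_set F \<and> (\<forall>\<phi>. \<not> models \<phi> F) \<and> (\<forall>C\<in>F. \<exists>\<phi>. models \<phi> (F - {C}))"
proof (cases "is_clause_set F")
  case True
  have sat: "satisfiable G \<longleftrightarrow> (\<exists>\<phi>. models \<phi> G)" if "G \<subseteq> F" for G
    using True that is_clause_set_subset satisfiable_iff_models by blast
  have "(\<forall>G. G \<subset> F \<longrightarrow> satisfiable G) \<longleftrightarrow> (\<forall>C\<in>F. \<exists>\<phi>. models \<phi> (F - {C}))"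
  proof
    assume "\<forall>G. G \<subset> F \<longrightarrow> satisfiable G"
    then show "\<forall>C\<in>F. \<exists>\<phi>. models \<phi> (F - {C})"
      using sat by (metis Diff_iff Diff_subset insertI1 psubsetI)
  next
    assume r: "\<forall>C\<in>F. \<exists>\<phi>. models \<phi> (F - {C})"
    show "\<forall>G. G \<subset> F \<longrightarrow> satisfiable G"
    proof (intro allI impI)
      fix G assume G: "G \<subset> F"
      then obtain C where "C \<in> F" "G \<subseteq> F - {C}" by blast
      then show "satisfiable G" using r sat G models_mono by (metis psubset_imp_subset)
    qed
  qed
  then show ?thesis using True sat[of F] by (auto simp: MU_def)
qed (simp add: MU_def)

lemma MU_D:
  assumes "F \<in> MU"
  shows MU_clause_set: "is_clause_set F" and MU_unsat: "\<not> models \<phi> F"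
    and MU_remove: "C \<in> F \<Longrightarrow> \<exists>\<phi>. models \<phi> (F - {C}) \<and> (\<forall>x\<in>C. \<not> lit_true \<phi> x)"
proof -
  show "is_clause_set F" "\<not> models \<phi> F" using assms by (auto simp: MU_iff)
  assume "C \<in> F"
  then obtain \<phi> where \<phi>: "models \<phi> (F - {C})" using assms by (auto simp: MU_iff)
  moreover have "\<not> models \<phi> F" using assms by (auto simp: MU_iff)
  ultimately have "\<forall>x\<in>C. \<not> lit_true \<phi> x" by (auto simp: models_def)
  with \<phi> show "\<exists>\<phi>. models \<phi> (F - {C}) \<and> (\<forall>x\<in>C. \<not> lit_true \<phi> x)" by blast
qed

text \<open>A model of \<open>F - {D}\<close> must falsify \<open>D\<close> and hence its subset
  \<open>C\<close>, although a clause \<open>C\<close> other than \<open>D\<close> would have to be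
  satisfied.\<close>

lemma MU_antichain:
  assumes "F \<in> MU" "C \<in> F" "D \<in> F" "C \<subseteq> D"
  shows "C = D"
proof (rule ccontr)
  assume ne: "C \<noteq> D"
  obtain \<phi> where \<phi>: "models \<phi> (F - {D})" "\<forall>x\<in>D. \<not> lit_true \<phi> x"
    using MU_remove assms by blast
  then show False using ne assms by (auto simp: models_def)
qed

lemma MU_finite: "F \<in> MU \<Longrightarrow> finite F"
  using MU_clause_set clause_setD by blast

lemma MU_nonempty: "F \<in> MU \<Longrightarrow> F \<noteq> {}"
  using MU_unsat by (auto simp: models_def)

lemma MU_empty_clause: "F \<in> MU \<Longrightarrow> {} \<in> F \<Longrightarrow> F = {{}}"
  using MU_antichain by blast

lemma MU_no_vars: "F \<in> MU \<Longrightarrow> cs_vars F = {} \<Longrightarrow> F = {{}}"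
  using MU_nonempty by (fastforce simp: cs_vars_def clause_vars_def)

lemma deficiency_empty_clause: "deficiency {{}} = 1"
  by (simp add: deficiency_def num_clauses_def num_vars_def cs_vars_def clause_vars_def)

lemma in_cs_vars: "C \<in> F \<Longrightarrow> x \<in> C \<Longrightarrow> lit_var x \<in> cs_vars F"
  by (auto simp: cs_vars_def clause_vars_def)

lemma cs_varsE:
  assumes "v \<in> cs_vars F"
  obtains C x where "C \<in> F" "x \<in> C" "lit_var x = v"
  using assms by (auto simp: cs_vars_def clause_vars_def)

section \<open>Literal degrees\<close>

definition ld :: "'v literal set set \<Rightarrow> 'v literal \<Rightarrow> nat" where
  "ld F l = card {C \<in> F. l \<in> C}"

lemma in_clause_vars_iff: "lit_var l \<in> clause_vars C \<longleftrightarrow> l \<in> C \<or> complement l \<in> C"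
  by (auto simp: clause_vars_def image_iff lit_var_eq_iff) (metis complement_complement)+

lemma var_degree_eq_ld:
  assumes "is_clause_set F"
  shows "var_degree F (lit_var l) = ld F l + ld F (complement l)"
proof -
  have "{C \<in> F. lit_var l \<in> clause_vars C} = {C \<in> F. l \<in> C} \<union> {C \<in> F. complement l \<in> C}"
    by (auto simp: in_clause_vars_iff)
  moreover have "{C \<in> F. l \<in> C} \<inter> {C \<in> F. complement l \<in> C} = {}"
    using clause_setD(3)[OF assms] by blast
  ultimately show ?thesis
    using clause_setD(1)[OF assms] by (simp add: var_degree_def ld_def card_Un_disjoint)
qed

text \<open>If \<open>l\<close> never occurred, making \<open>complement l\<close> true would
  satisfy \<open>C\<close> without hurting a model of \<open>F - {C}\<close>.\<close>

lemma MU_literal_occurs: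
  assumes F: "F \<in> MU" and l: "lit_var l \<in> cs_vars F"
  shows "\<exists>C\<in>F. l \<in> C"
proof (rule ccontr)
  assume no: "\<not> (\<exists>C\<in>F. l \<in> C)"
  obtain C x where C: "C \<in> F" "x \<in> C" "lit_var x = lit_var l"
    using l by (rule cs_varsE)
  then have "complement l \<in> C" using no lit_var_eq_iff by metis
  obtain \<phi> where \<phi>: "models \<phi> (F - {C})" using MU_remove F C by blast
  have "models (set_true (complement l) \<phi>) F"
    unfolding models_def
  proof
    fix D assume D: "D \<in> F"
    show "\<exists>x\<in>D. lit_true (set_true (complement l) \<phi>) x"
    proof (cases "D = C")
      case True then show ?thesis using \<open>complement l \<in> C\<close> set_true_self by blast
    next
      case False
      then obtain x where "x \<in> D" "lit_true \<phi> x" using \<phi> D by (auto simp: models_def)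
      moreover have "x \<noteq> l" using no D \<open>x \<in> D\<close> by blast
      ultimately show ?thesis using set_true_mono[of \<phi> x "complement l"] by auto
    qed
  qed
  then show False using MU_unsat F by blast
qed

lemma MU_ld_pos: "F \<in> MU \<Longrightarrow> lit_var l \<in> cs_vars F \<Longrightarrow> 1 \<le> ld F l"
  using MU_literal_occurs[of F l] MU_finite[of F] by (auto simp: ld_def Suc_le_eq card_gt_0_iff)

section \<open>Setting a literal to true\<close>

definition assign :: "'v literal set set \<Rightarrow> 'v literal \<Rightarrow> 'v literal set set" where
  "assign F l = (\<lambda>C. C - {complement l}) ` {C \<in> F. l \<notin> C}"

lemma assign_clause_set: "is_clause_set F \<Longrightarrow> is_clause_set (assign F l)"
  by (auto simp: assign_def is_clause_set_def is_clause_def)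

lemma models_assign_iff:
  assumes "lit_true \<phi> l"
  shows "models \<phi> (assign F l) \<longleftrightarrow> models \<phi> F"
  using assms by (auto simp: models_def assign_def) (metis Diff_iff lit_true_complement singletonD)+

lemma assign_no_var: 
  assumes "C \<in> assign F l" "x \<in> C"
  shows "lit_var x \<noteq> lit_var l"
  using assms by (auto simp: assign_def lit_var_eq_iff)

lemma models_assign_set_true: "models \<phi> (assign F l) \<longleftrightarrow> models (set_true l \<phi>) (assign F l)"
  unfolding models_def by (metis assign_no_var set_true_other)

lemma assign_unsat: "\<forall>\<phi>. \<not> models \<phi> F \<Longrightarrow> \<not> models \<phi> (assign F l)"
  by (metis models_assign_set_true models_assign_iff set_true_self)

text \<open>Two clauses with the same image differ at most in \<open>complement l\<close>, so they
  are comparable and the antichain property applies. Hence no clauses merge, and all counts after an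
  assignment are exact.\<close>

lemma assign_inj:
  assumes "F \<in> MU"
  shows "inj_on (\<lambda>C. C - {complement l}) {C \<in> F. l \<notin> C}"
proof (rule inj_onI)
  fix C D assume C: "C \<in> {C \<in> F. l \<notin> C}" and D: "D \<in> {C \<in> F. l \<notin> C}"
    and eq: "C - {complement l} = D - {complement l}"
  then have "C \<subseteq> D \<or> D \<subseteq> C" by blast
  then show "C = D" using MU_antichain[OF assms] C D by blast
qed

lemma card_assign:
  assumes "F \<in> MU"
  shows "card F = card (assign F l) + ld F l"
proof -
  have "F = {C \<in> F. l \<notin> C} \<union> {C \<in> F. l \<in> C}" by blast
  then have "card F = card {C \<in> F. l \<notin> C} + card {C \<in> F. l \<in> C}"
    using MU_finite[OF assms] by (subst card_Un_disjoint[symmetric]) auto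
  then show ?thesis by (simp add: assign_def card_image assign_inj[OF assms] ld_def)
qed

lemma card_filter_assign:
  assumes F: "F \<in> MU" and P: "\<And>C. P (C - {complement l}) = P C"
  shows "card {C \<in> F. P C} = card {C \<in> assign F l. P C} + card {C \<in> F. l \<in> C \<and> P C}"
proof -
  have "{C \<in> F. P C} = {C \<in> F. l \<notin> C \<and> P C} \<union> {C \<in> F. l \<in> C \<and> P C}" by blast
  then have "card {C \<in> F. P C} = card {C \<in> F. l \<notin> C \<and> P C} + card {C \<in> F. l \<in> C \<and> P C}"
    using MU_finite[OF F] by (subst card_Un_disjoint[symmetric]) auto
  moreover have "{C \<in> assign F l. P C} = (\<lambda>C. C - {complement l}) ` {C \<in> F. l \<notin> C \<and> P C}"
    using P by (auto simp: assign_def)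
  moreover have "inj_on (\<lambda>C. C - {complement l}) {C \<in> F. l \<notin> C \<and> P C}"
    by (rule inj_on_subset[OF assign_inj[OF F, of l]]) auto
  ultimately show ?thesis by (simp add: card_image)
qed

lemma var_degree_assign:
  assumes "F \<in> MU" "w \<noteq> lit_var l"
  shows "var_degree F w = var_degree (assign F l) w + card {C \<in> F. l \<in> C \<and> w \<in> clause_vars C}"
  unfolding var_degree_def
  by (rule card_filter_assign[OF assms(1)]) (use assms(2) in \<open>auto simp: clause_vars_def\<close>)

lemma ld_assign:
  assumes "F \<in> MU" "lit_var m \<noteq> lit_var l"
  shows "ld F m = ld (assign F l) m + card {C \<in> F. l \<in> C \<and> m \<in> C}"
  unfolding ld_def
  by (rule card_filter_assign[OF assms(1)]) (use assms(2) in auto)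

lemma card_lits_le_ld: "F \<in> MU \<Longrightarrow> card {C \<in> F. l \<in> C \<and> P C} \<le> ld F l"
  unfolding ld_def by (rule card_mono) (auto simp: MU_finite)

lemma cs_vars_assign_subset: "cs_vars (assign F l) \<subseteq> cs_vars F - {lit_var l}"
proof
  fix v assume "v \<in> cs_vars (assign F l)"
  then obtain C x where "C \<in> assign F l" "x \<in> C" "lit_var x = v" by (rule cs_varsE)
  then show "v \<in> cs_vars F - {lit_var l}"
    using assign_no_var[of C F l x] in_cs_vars[of _ F x] by (auto simp: assign_def)
qed

lemma var_degree_pos_iff: "finite F \<Longrightarrow> 0 < var_degree F v \<longleftrightarrow> v \<in> cs_vars F"
  by (auto simp: var_degree_def card_gt_0_iff cs_vars_def)

text \<open>A variable can vanish only if all its occurrences lie in the \<open>ld F l\<close>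
  satisfied clauses.\<close>

lemma cs_vars_assign:
  assumes F: "F \<in> MU" and deg: "\<And>w. w \<in> cs_vars F \<Longrightarrow> w \<noteq> lit_var l \<Longrightarrow> ld F l < var_degree F w"
  shows "cs_vars (assign F l) = cs_vars F - {lit_var l}"
proof
  show "cs_vars F - {lit_var l} \<subseteq> cs_vars (assign F l)"
  proof
    fix w assume w: "w \<in> cs_vars F - {lit_var l}"
    then have "0 < var_degree (assign F l) w"
      using var_degree_assign[OF F, of w l] deg[of w] card_lits_le_ld[OF F, of l "\<lambda>C. w \<in> clause_vars C"]
      by auto
    then show "w \<in> cs_vars (assign F l)"
      using assign_clause_set[OF MU_clause_set[OF F]] clause_setD(1) var_degree_pos_iff by metis
  qed
qed (rule cs_vars_assign_subset)

lemma deficiency_assign: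
  assumes F: "F \<in> MU" and l: "lit_var l \<in> cs_vars F"
    and vs: "cs_vars (assign F l) = cs_vars F - {lit_var l}"
  shows "deficiency (assign F l) = deficiency F - int (ld F l) + 1"
proof -
  have "card (cs_vars F) = card (cs_vars (assign F l)) + 1"
    using vs l finite_cs_vars[OF MU_clause_set[OF F]] card_Suc_Diff1 by fastforce
  then show ?thesis
    using card_assign[OF F, of l] by (simp add: deficiency_def num_clauses_def num_vars_def)
qed


section \<open>Reduction to the empty clause, and unit propagation\<close>

lemma ld_complement_le_1:
  assumes F: "F \<in> MU" and e: "assign F l = {{}}"
  shows "ld F (complement l) \<le> 1"
proof -
  have "{C \<in> F. complement l \<in> C} \<subseteq> {{complement l}}"
  proof
    fix C assume C: "C \<in> {C \<in> F. complement l \<in> C}"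
    then have "l \<notin> C" using clause_setD(3)[OF MU_clause_set[OF F]] by force
    then have "C - {complement l} \<in> assign F l" using C by (auto simp: assign_def)
    then show "C \<in> {{complement l}}" using e C by auto
  qed
  then show ?thesis
    unfolding ld_def using card_mono[of "{{complement l}}"] by fastforce
qed

lemma assign_cs_vars_ne:
  assumes "F \<in> MU" "assign F l \<in> MU" "2 \<le> ld F (complement l)"
  shows "cs_vars (assign F l) \<noteq> {}"
  using ld_complement_le_1[OF assms(1), of l] MU_no_vars[OF assms(2)] assms(3) by fastforce

lemma unit_clause_ld:
  assumes F: "F \<in> MU" and u: "{l} \<in> F"
  shows "ld F l = 1"
proof -
  have "C = {l}" if "C \<in> F" "l \<in> C" for C
    using MU_antichain[OF F u that(1)] that(2) by simp
  then have "{C \<in> F. l \<in> C} = {{l}}"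
    using u by blast
  then show ?thesis by (simp add: ld_def)
qed

lemma MU_var_degree_ge2:
  assumes "F \<in> MU" "v \<in> cs_vars F"
  shows "2 \<le> var_degree F v"
  using MU_ld_pos[OF assms(1), of "Pos v"] MU_ld_pos[OF assms(1), of "Neg v"] assms
    var_degree_eq_ld[OF MU_clause_set[OF assms(1)], of "Pos v"] by simp

text \<open>By the antichain property \<open>{l}\<close> is the only clause through
  \<open>l\<close>, so nothing else is satisfied. Minimality survives because every model of
  \<open>F - {C}\<close> with \<open>C \<noteq> {l}\<close> already makes \<open>l\<close>
  true.\<close>

lemma unit_propagation:
  assumes F: "F \<in> MU" and u: "{l} \<in> F"
  shows "assign F l \<in> MU"
    and "cs_vars (assign F l) = cs_vars F - {lit_var l}"
    and "card (assign F l) = card F - 1"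
    and "deficiency (assign F l) = deficiency F"
    and "lit_var m \<noteq> lit_var l \<Longrightarrow> ld (assign F l) m = ld F m"
    and "w \<noteq> lit_var l \<Longrightarrow> var_degree (assign F l) w = var_degree F w"
proof -
  show "assign F l \<in> MU"
    unfolding MU_iff
  proof (intro conjI allI ballI)
    show "is_clause_set (assign F l)" by (rule assign_clause_set[OF MU_clause_set[OF F]])
    show "\<not> models \<phi> (assign F l)" for \<phi> using assign_unsat MU_unsat[OF F] by blast
    fix D assume "D \<in> assign F l"
    then obtain C where C: "C \<in> F" "l \<notin> C" "D = C - {complement l}" by (auto simp: assign_def)
    obtain \<phi> where \<phi>: "models \<phi> (F - {C})" using MU_remove[OF F C(1)] by blast
    moreover have "{l} \<in> F - {C}" using u C by blast
    ultimately have "lit_true \<phi> l" unfolding models_def by blast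
    have "models \<phi> (assign F l - {D})"
      unfolding models_def
    proof
      fix E assume "E \<in> assign F l - {D}"
      then obtain C' where C': "C' \<in> F" "l \<notin> C'" "E = C' - {complement l}" "C' \<noteq> C"
        using C by (auto simp: assign_def)
      then obtain x where "x \<in> C'" "lit_true \<phi> x" using \<phi> by (auto simp: models_def)
      then show "\<exists>x\<in>E. lit_true \<phi> x"
        using C' \<open>lit_true \<phi> l\<close> by (intro bexI[of _ x]) auto
    qed
    then show "\<exists>\<phi>. models \<phi> (assign F l - {D})" by blast
  qed
  have "C = {l}" if "C \<in> F" "l \<in> C" for C
    using MU_antichain[OF F u that(1)] that(2) by simp
  then have sing: "{C \<in> F. l \<in> C \<and> P C} = {}" if "\<not> P {l}" for P
    using that by blast
  show vs: "cs_vars (assign F l) = cs_vars F - {lit_var l}"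
  proof (rule cs_vars_assign[OF F])
    fix w assume "w \<in> cs_vars F"
    from MU_var_degree_ge2[OF F this] show "ld F l < var_degree F w"
      using unit_clause_ld[OF F u] by simp
  qed
  show "card (assign F l) = card F - 1"
    using card_assign[OF F, of l] unit_clause_ld[OF F u] by simp
  have "lit_var l \<in> cs_vars F" using in_cs_vars[OF u] by simp
  then show "deficiency (assign F l) = deficiency F"
    using deficiency_assign[OF F _ vs] unit_clause_ld[OF F u] by simp
  show "ld (assign F l) m = ld F m" if "lit_var m \<noteq> lit_var l"
  proof -
    have "{C \<in> F. l \<in> C \<and> m \<in> C} = {}" using sing[of "\<lambda>C. m \<in> C"] that by fastforce
    then show ?thesis using ld_assign[OF F that] by (metis add.right_neutral card.empty)
  qed
  show "var_degree (assign F l) w = var_degree F w" if "w \<noteq> lit_var l"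
  proof -
    have "{C \<in> F. l \<in> C \<and> w \<in> clause_vars C} = {}"
      using sing[of "\<lambda>C. w \<in> clause_vars C"] that by (simp add: clause_vars_def)
    then show ?thesis using var_degree_assign[OF F that] by (metis add.right_neutral card.empty)
  qed
qed

section \<open>Saturation\<close>

text \<open>Equivalently, no literal over \<open>cs_vars F\<close> can be added to a clause without
  making the clause-set satisfiable. The form with models is the one that assignments use.\<close>

definition saturated :: "'v literal set set \<Rightarrow> bool" where
  "saturated F \<longleftrightarrow> F \<in> MU \<and>
     (\<forall>C\<in>F. \<forall>l. lit_var l \<in> cs_vars F \<longrightarrow> l \<notin> C \<longrightarrow> complement l \<notin> C \<longrightarrow>
        (\<exists>\<phi>. models \<phi> (F - {C}) \<and> lit_true \<phi> l \<and> (\<forall>x\<in>C. \<not> lit_true \<phi> x)))"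

text \<open>The bijection keeps the number of clauses, hence the deficiency, while the inclusions
  let degrees only grow.\<close>

definition extends :: "'v literal set set \<Rightarrow> 'v literal set set \<Rightarrow> bool" where
  "extends F F' \<longleftrightarrow> (\<exists>g. bij_betw g F F' \<and> (\<forall>C\<in>F. C \<subseteq> g C)) \<and> cs_vars F' = cs_vars F"

lemma extends_refl: "extends F F"
  unfolding extends_def by (intro conjI exI[of _ id]) auto

lemma extends_trans:
  assumes "extends F G" "extends G H"
  shows "extends F H"
proof -
  obtain g h where g: "bij_betw g F G" "\<forall>C\<in>F. C \<subseteq> g C" and h: "bij_betw h G H" "\<forall>C\<in>G. C \<subseteq> h C"
    using assms by (auto simp: extends_def)
  have "bij_betw (h \<circ> g) F H" using g(1) h(1) by (rule bij_betw_trans)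
  moreover have "C \<subseteq> (h \<circ> g) C" if "C \<in> F" for C
  proof -
    have "g C \<in> G" using bij_betwE[OF g(1)] that by blast
    then have "g C \<subseteq> h (g C)" using h(2) by blast
    then show ?thesis using g(2) that by (metis comp_apply subset_trans)
  qed
  moreover have "cs_vars H = cs_vars F" using assms by (simp add: extends_def)
  ultimately show ?thesis unfolding extends_def by blast
qed

lemma extends_card: "extends F F' \<Longrightarrow> card F' = card F"
  by (auto simp: extends_def dest: bij_betw_same_card)

lemma extends_cs_vars: "extends F F' \<Longrightarrow> cs_vars F' = cs_vars F"
  by (simp add: extends_def)

lemma extends_deficiency: "extends F F' \<Longrightarrow> deficiency F' = deficiency F"
  by (simp add: deficiency_def num_clauses_def num_vars_def extends_card extends_cs_vars)

lemma extends_filter_le: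
  assumes "extends F F'" "finite F'" "\<And>C D. C \<subseteq> D \<Longrightarrow> P C \<Longrightarrow> P D"
  shows "card {C \<in> F. P C} \<le> card {C \<in> F'. P C}"
proof -
  obtain g where g: "bij_betw g F F'" "\<forall>C\<in>F. C \<subseteq> g C" using assms by (auto simp: extends_def)
  show ?thesis
  proof (rule card_inj_on_le)
    show "inj_on g {C \<in> F. P C}"
      by (rule inj_on_subset[OF bij_betw_imp_inj_on[OF g(1)]]) auto
    show "g ` {C \<in> F. P C} \<subseteq> {C \<in> F'. P C}"
    proof
      fix D assume "D \<in> g ` {C \<in> F. P C}"
      then obtain C where C: "C \<in> F" "P C" "D = g C" by blast
      then have "P D" using assms(3)[of C D] g(2) by blast
      moreover have "D \<in> F'" using bij_betwE[OF g(1)] C by blast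
      ultimately show "D \<in> {C \<in> F'. P C}" by blast
    qed
    show "finite {C \<in> F'. P C}" using assms(2) by simp
  qed
qed

lemma extends_ld_le: "extends F F' \<Longrightarrow> finite F' \<Longrightarrow> ld F l \<le> ld F' l"
  unfolding ld_def by (rule extends_filter_le) auto

lemma extends_var_degree_le: "extends F F' \<Longrightarrow> finite F' \<Longrightarrow> var_degree F v \<le> var_degree F' v"
  unfolding var_degree_def by (rule extends_filter_le) (auto simp: clause_vars_def)

lemma extends_supersetE:
  assumes "extends F F'" "D \<in> F'"
  obtains C where "C \<in> F" "C \<subseteq> D"
proof -
  obtain g where g: "bij_betw g F F'" "\<forall>C\<in>F. C \<subseteq> g C" using assms(1) by (auto simp: extends_def)
  then obtain C where "C \<in> F" "D = g C" using assms(2) by (auto simp: bij_betw_def)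
  then show ?thesis using that g(2) by blast
qed

text \<open>Repairs one failure of saturation; the last conclusion measures the progress.\<close>

lemma MU_add_literal:
  assumes F: "F \<in> MU" and C: "C \<in> F" and l: "lit_var l \<in> cs_vars F" "l \<notin> C" "complement l \<notin> C"
    and unsat: "\<forall>\<phi>. \<not> (models \<phi> (F - {C}) \<and> lit_true \<phi> l \<and> (\<forall>x\<in>C. \<not> lit_true \<phi> x))"
  defines "F' \<equiv> insert (insert l C) (F - {C})"
  shows "F' \<in> MU" "extends F F'" "(\<Sum>D\<in>F'. card D) = Suc (\<Sum>D\<in>F. card D)"
proof -
  have new: "insert l C \<notin> F" using MU_antichain[OF F C, of "insert l C"] l(2) by blast
  have fin: "finite F" "finite C" using clause_setD MU_clause_set[OF F] C by blast+
  show "F' \<in> MU"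
    unfolding MU_iff
  proof (intro conjI allI ballI)
    have "is_clause C" using MU_clause_set[OF F] C by (auto simp: is_clause_set_def)
    then have "is_clause (insert l C)" using l by (auto simp: is_clause_def)
    then show "is_clause_set F'" using MU_clause_set[OF F] by (auto simp: F'_def is_clause_set_def)
    show "\<not> models \<phi> F'" for \<phi>
    proof
      assume m: "models \<phi> F'"
      then have m1: "models \<phi> (F - {C})" and m2: "\<exists>x\<in>insert l C. lit_true \<phi> x"
        unfolding F'_def models_def by simp_all
      then have "\<forall>x\<in>C. \<not> lit_true \<phi> x"
        using MU_unsat[OF F, of \<phi>] unfolding models_def by blast
      then show False using unsat m1 m2 by blast
    qed
    fix D assume D: "D \<in> F'"
    show "\<exists>\<phi>. models \<phi> (F' - {D})"
    proof (cases "D = insert l C")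
      case True
      obtain \<phi> where \<phi>: "models \<phi> (F - {C})" using MU_remove[OF F C] by blast
      have "F' - {D} \<subseteq> F - {C}" using True by (auto simp: F'_def)
      then show ?thesis using models_mono[OF \<phi>] by blast
    next
      case False
      then have "D \<in> F" "D \<noteq> C" using D by (auto simp: F'_def)
      then obtain \<phi> where \<phi>: "models \<phi> (F - {D})" using MU_remove[OF F] by blast
      have "\<exists>x\<in>E. lit_true \<phi> x" if "E \<in> F' - {D}" for E
      proof (cases "E = insert l C")
        case True
        then show ?thesis using \<phi> C \<open>D \<noteq> C\<close> unfolding models_def by blast
      next
        case False
        then have "E \<in> F - {D}" using that by (simp add: F'_def)
        then show ?thesis using \<phi> unfolding models_def by blast
      qed
      then show ?thesis unfolding models_def by blast
    qed
  qed
  let ?g = "id(C := insert l C)"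
  have "bij_betw ?g F F'"
    unfolding bij_betw_def
  proof
    show "inj_on ?g F" using new by (auto simp: inj_on_def)
    show "?g ` F = F'" using C unfolding F'_def by (force simp: fun_upd_def)
  qed
  moreover have "\<forall>D\<in>F. D \<subseteq> ?g D" by auto
  moreover have "cs_vars F' = cs_vars F"
    using C l(1) by (auto simp: F'_def cs_vars_def clause_vars_def)
  ultimately show "extends F F'" unfolding extends_def by blast
  have "(\<Sum>D\<in>F'. card D) = card (insert l C) + (\<Sum>D\<in>F - {C}. card D)"
    unfolding F'_def using new fin by (subst sum.insert) auto
  also have "card (insert l C) = Suc (card C)" using fin l by simp
  also have "Suc (card C) + (\<Sum>D\<in>F - {C}. card D) = Suc (card C + (\<Sum>D\<in>F - {C}. card D))" by simp
  also have "card C + (\<Sum>D\<in>F - {C}. card D) = (\<Sum>D\<in>F. card D)"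
    by (rule sum.remove[OF fin(1) C, symmetric])
  finally show "(\<Sum>D\<in>F'. card D) = Suc (\<Sum>D\<in>F. card D)" .
qed

lemma card_clause_vars:
  assumes "is_clause C"
  shows "card (clause_vars C) = card C"
proof -
  have "inj_on lit_var C" using assms by (auto simp: inj_on_def lit_var_eq_iff is_clause_def)
  then show ?thesis by (simp add: clause_vars_def card_image)
qed

text \<open>There is room for at most \<open>card F * card (cs_vars F)\<close> literal occurrences,
  and every repair uses up one.\<close>

lemma saturation_exists:
  assumes "F \<in> MU"
  shows "\<exists>F'. saturated F' \<and> extends F F'"
  using assms
proof (induction "card F * card (cs_vars F) - (\<Sum>D\<in>F. card D)" arbitrary: F rule: less_induct)
  case less
  show ?case
  proof (cases "saturated F")
    case True
    then show ?thesis using extends_refl by blast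
  next
    case False
    then obtain C l where C: "C \<in> F" "lit_var l \<in> cs_vars F" "l \<notin> C" "complement l \<notin> C"
      "\<forall>\<phi>. \<not> (models \<phi> (F - {C}) \<and> lit_true \<phi> l \<and> (\<forall>x\<in>C. \<not> lit_true \<phi> x))"
      using less.prems by (auto simp: saturated_def)
    define F' where "F' = insert (insert l C) (F - {C})"
    have F': "F' \<in> MU" "extends F F'" "(\<Sum>D\<in>F'. card D) = Suc (\<Sum>D\<in>F. card D)"
      using MU_add_literal[OF less.prems C] by (simp_all add: F'_def)
    have "(\<Sum>D\<in>F'. card D) \<le> (\<Sum>D\<in>F'. card (cs_vars F'))"
    proof (rule sum_mono)
      fix D assume D: "D \<in> F'"
      have "card D = card (clause_vars D)"
        using MU_clause_set[OF F'(1)] D card_clause_vars[of D] by (simp add: is_clause_set_def)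
      also have "\<dots> \<le> card (cs_vars F')"
        using D finite_cs_vars[OF MU_clause_set[OF F'(1)]] by (intro card_mono) (auto simp: cs_vars_def)
      finally show "card D \<le> card (cs_vars F')" .
    qed
    then have "Suc (\<Sum>D\<in>F. card D) \<le> card F * card (cs_vars F)"
      using F' extends_card[OF F'(2)] extends_cs_vars[OF F'(2)] by simp
    then have "card F' * card (cs_vars F') - (\<Sum>D\<in>F'. card D) < card F * card (cs_vars F) - (\<Sum>D\<in>F. card D)"
      using F' extends_card[OF F'(2)] extends_cs_vars[OF F'(2)] by simp
    from less.hyps[OF this F'(1)] show ?thesis using F'(2) extends_trans by blast
  qed
qed

lemma saturated_MU: "saturated F \<Longrightarrow> F \<in> MU"
  by (simp add: saturated_def)

text \<open>Needed is a model of \<open>F - {C}\<close> that makes \<open>l\<close> true. If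
  \<open>complement l \<in> C\<close>, every model of \<open>F - {C}\<close> does, since it
  falsifies \<open>C\<close>; otherwise saturation supplies one.\<close>

lemma saturated_assign_MU:
  assumes F: "saturated F" and l: "lit_var l \<in> cs_vars F"
  shows "assign F l \<in> MU"
  unfolding MU_iff
proof (intro conjI allI ballI)
  have M: "F \<in> MU" using F by (rule saturated_MU)
  show "is_clause_set (assign F l)" by (rule assign_clause_set[OF MU_clause_set[OF M]])
  show "\<not> models \<phi> (assign F l)" for \<phi> using assign_unsat MU_unsat[OF M] by blast
  fix D assume "D \<in> assign F l"
  then obtain C where C: "C \<in> F" "l \<notin> C" "D = C - {complement l}" by (auto simp: assign_def)
  obtain \<phi> where \<phi>: "models \<phi> (F - {C})" "lit_true \<phi> l"
  proof (cases "complement l \<in> C")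
    case True
    then show ?thesis using MU_remove[OF M C(1)] that by fastforce
  next
    case False
    then have "\<exists>\<phi>. models \<phi> (F - {C}) \<and> lit_true \<phi> l"
      using F C l unfolding saturated_def by blast
    then show ?thesis using that by blast
  qed
  have "models \<phi> (assign F l - {D})"
    unfolding models_def
  proof
    fix E assume "E \<in> assign F l - {D}"
    then obtain C' where C': "C' \<in> F" "l \<notin> C'" "E = C' - {complement l}" "C' \<noteq> C"
      using C by (auto simp: assign_def)
    then obtain x where "x \<in> C'" "lit_true \<phi> x" using \<phi> by (auto simp: models_def)
    then show "\<exists>x\<in>E. lit_true \<phi> x"
      using C' \<open>lit_true \<phi> l\<close> by (intro bexI[of _ x]) auto
  qed
  then show "\<exists>\<phi>. models \<phi> (assign F l - {D})" by blast
qed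

lemma ex_min_var_degree:
  assumes "cs_vars F \<noteq> {}"
  shows "\<exists>v\<in>cs_vars F. \<forall>w\<in>cs_vars F. var_degree F v \<le> var_degree F w"
  using ex_has_least_nat[of "\<lambda>v. v \<in> cs_vars F" _ "var_degree F"] assms by blast

text \<open>Every variable has degree at least \<open>ld F l + ld F (complement l)\<close>. This
  exceeds \<open>ld F l\<close>, since both literals occur, so only the assigned variable
  disappears.\<close>

lemma split_min_degree:
  assumes F: "saturated F" and l: "lit_var l \<in> cs_vars F"
    and min: "\<And>w. w \<in> cs_vars F \<Longrightarrow> var_degree F (lit_var l) \<le> var_degree F w"
  shows "assign F l \<in> MU"
    and "cs_vars (assign F l) = cs_vars F - {lit_var l}"
    and "deficiency (assign F l) = deficiency F - int (ld F l) + 1"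
    and "var_degree F (lit_var l) = ld F l + ld F (complement l)"
    and "1 \<le> ld F l"
proof -
  have M: "F \<in> MU" using F by (rule saturated_MU)
  show "assign F l \<in> MU" by (rule saturated_assign_MU[OF F l])
  show eq: "var_degree F (lit_var l) = ld F l + ld F (complement l)"
    by (rule var_degree_eq_ld[OF MU_clause_set[OF M]])
  have "1 \<le> ld F (complement l)" using MU_ld_pos[OF M, of "complement l"] l by simp
  then show "cs_vars (assign F l) = cs_vars F - {lit_var l}"
    using min eq by (intro cs_vars_assign[OF M]) force
  then show "deficiency (assign F l) = deficiency F - int (ld F l) + 1"
    by (rule deficiency_assign[OF M l])
  show "1 \<le> ld F l" by (rule MU_ld_pos[OF M l])
qed

lemma saturated_min_literal:
  assumes F: "saturated F" and ne: "cs_vars F \<noteq> {}"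
  obtains l where "lit_var l \<in> cs_vars F"
    "\<And>w. w \<in> cs_vars F \<Longrightarrow> var_degree F (lit_var l) \<le> var_degree F w"
    "ld F (complement l) \<le> ld F l"
proof -
  obtain v where v: "v \<in> cs_vars F" "\<forall>w\<in>cs_vars F. var_degree F v \<le> var_degree F w"
    using ex_min_var_degree[OF ne] by blast
  show ?thesis
  proof (cases "ld F (Neg v) \<le> ld F (Pos v)")
    case True then show ?thesis using that[of "Pos v"] v by simp
  next
    case False then show ?thesis using that[of "Neg v"] v by simp
  qed
qed

lemma var_degree_assign_ge:
  assumes "F \<in> MU" "w \<noteq> lit_var l"
  shows "var_degree F w - ld F l \<le> var_degree (assign F l) w"
  using var_degree_assign[OF assms] card_lits_le_ld[OF assms(1), of l "\<lambda>C. w \<in> clause_vars C"] by simp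

text \<open>Tarsi's lemma. A split lowers the deficiency by \<open>ld F l - 1\<close>, which is not
  negative, and removes a variable, down to \<open>{{}}\<close>.\<close>

theorem MU_deficiency_pos: "F \<in> MU \<Longrightarrow> 1 \<le> deficiency F"
proof (induction "card (cs_vars F)" arbitrary: F rule: less_induct)
  case less
  show ?case
  proof (cases "cs_vars F = {}")
    case True
    then have "F = {{}}" using MU_no_vars less.prems by blast
    then show ?thesis by (simp add: deficiency_empty_clause)
  next
    case False
    obtain F' where F': "saturated F'" "extends F F'" using saturation_exists less.prems by blast
    have vs: "cs_vars F' = cs_vars F" using F' extends_cs_vars by blast
    obtain l where l: "lit_var l \<in> cs_vars F'"
      "\<And>w. w \<in> cs_vars F' \<Longrightarrow> var_degree F' (lit_var l) \<le> var_degree F' w"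
      using saturated_min_literal[OF F'(1)] False vs by metis
    note s = split_min_degree[OF F'(1) l]
    have "card (cs_vars (assign F' l)) < card (cs_vars F)"
      using s(2) l(1) vs finite_cs_vars[OF MU_clause_set[OF less.prems]]
      by (metis card_Diff1_less)
    then have "1 \<le> deficiency (assign F' l)" using less.hyps s(1) by blast
    then show ?thesis using s(3,5) extends_deficiency[OF F'(2)] by simp
  qed
qed

lemma ld_le_deficiency:
  assumes "saturated F" "lit_var l \<in> cs_vars F"
    "\<And>w. w \<in> cs_vars F \<Longrightarrow> var_degree F (lit_var l) \<le> var_degree F w"
  shows "int (ld F l) \<le> deficiency F"
  using split_min_degree(1,3)[OF assms] MU_deficiency_pos[of "assign F l"] by simp

text \<open>
  In the form \<open>\<delta> \<ge> d - \<lfloor>log 2 d\<rfloor>\<close>: with the two literals of a variable of minimum degree occurring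
  \<open>a \<ge> b\<close> times, setting the first one to true lowers the deficiency by \<open>a - 1\<close> and leaves degrees
  at least \<open>b\<close>, which costs only one binary digit.
\<close>

theorem MU_degree_bound:
  assumes "F \<in> MU" "cs_vars F \<noteq> {}" "\<And>v. v \<in> cs_vars F \<Longrightarrow> d \<le> var_degree F v" "d < 2 ^ Suc q"
  shows "int d \<le> deficiency F + int q"
  using assms
proof (induction "card (cs_vars F)" arbitrary: F d q rule: less_induct)
  case less
  obtain F' where F': "saturated F'" "extends F F'" using saturation_exists less.prems by blast
  have M: "F' \<in> MU" using F' saturated_MU by blast
  have vs: "cs_vars F' = cs_vars F" using F' extends_cs_vars by blast
  have df: "deficiency F' = deficiency F" using F' extends_deficiency by blast
  have deg: "d \<le> var_degree F' v" if "v \<in> cs_vars F'" for v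
    using less.prems(3)[of v] extends_var_degree_le[OF F'(2) MU_finite[OF M], of v] that vs by simp
  obtain l where l: "lit_var l \<in> cs_vars F'"
    "\<And>w. w \<in> cs_vars F' \<Longrightarrow> var_degree F' (lit_var l) \<le> var_degree F' w"
    "ld F' (complement l) \<le> ld F' l"
    using saturated_min_literal[OF F'(1)] less.prems(2) vs by metis
  note s = split_min_degree[OF F'(1) l(1,2)]
  have pos: "1 \<le> deficiency (assign F' l)" using MU_deficiency_pos s(1) by blast
  show ?case
  proof (cases "d \<le> ld F' l \<or> q = 0")
    case True
    then show ?thesis
    proof
      assume "d \<le> ld F' l" then show ?thesis using pos s(3) df by simp
    next
      assume "q = 0" then show ?thesis using MU_deficiency_pos[OF less.prems(1)] less.prems(4) by simp
    qed
  next
    case False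
    then obtain q' where q': "q = Suc q'" by (cases q) auto
    have dle: "d \<le> ld F' l + ld F' (complement l)" using deg[OF l(1)] s(4) by simp
    show ?thesis
    proof (cases "cs_vars (assign F' l) = {}")
      case True
      \<comment> \<open>With no variables left, the deficiency of \<open>F\<close> equals
        \<open>ld F' l\<close>, and \<open>complement l\<close> contributes at most 1 to
        \<open>d\<close>.\<close>
      then have e: "assign F' l = {{}}" using MU_no_vars s(1) by blast
      have "ld F' (complement l) \<le> 1" by (rule ld_complement_le_1[OF M e])
      moreover have "deficiency (assign F' l) = 1"
        using e by (simp add: deficiency_empty_clause)
      ultimately show ?thesis using dle s(3) df q' by simp
    next
      case ne: False
      have "card (cs_vars (assign F' l)) < card (cs_vars F)"
        using s(2) l(1) vs finite_cs_vars[OF MU_clause_set[OF less.prems(1)]]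
        by (metis card_Diff1_less)
      moreover have "d - ld F' l \<le> var_degree (assign F' l) w" if "w \<in> cs_vars (assign F' l)" for w
        using var_degree_assign_ge[OF M, of w l] deg[of w] that s(2) by auto
      \<comment> \<open>The choice of \<open>l\<close> gives \<open>d \<le> 2 * ld F' l\<close>, so
        the remainder is at most half of \<open>d\<close>.\<close>
      moreover have "d - ld F' l < 2 ^ Suc q'"
        using less.prems(4) q' dle l(3) by simp
      ultimately have "int (d - ld F' l) \<le> deficiency (assign F' l) + int q'"
        by (intro less.hyps) (use s(1) ne in auto)
      then show ?thesis using s(3) df q' False by simp
    qed
  qed
qed


section \<open>Deficiency one\<close>

text \<open>Minimum degree 3 has \<open>q = 1\<close> in the degree bound and would need deficiency
  2.\<close>

lemma MU1_degree_two:
  assumes "F \<in> MU" "deficiency F = 1" "cs_vars F \<noteq> {}"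
  shows "\<exists>v\<in>cs_vars F. var_degree F v = 2"
proof (rule ccontr)
  assume "\<not> ?thesis"
  then have "3 \<le> var_degree F v" if "v \<in> cs_vars F" for v
    using MU_var_degree_ge2[OF assms(1) that] that by fastforce
  then show False using MU_degree_bound[OF assms(1,3), of 3 1] assms(2) by simp
qed

lemma degree_two_clauses:
  assumes F: "F \<in> MU" and v: "v \<in> cs_vars F" "var_degree F v = 2" and l: "lit_var l = v"
  obtains C D where "C \<in> F" "D \<in> F" "l \<in> C" "complement l \<in> D"
    "\<forall>E\<in>F. l \<in> E \<longrightarrow> E = C" "\<forall>E\<in>F. complement l \<in> E \<longrightarrow> E = D"
proof -
  have "ld F l + ld F (complement l) = 2"
    using var_degree_eq_ld[OF MU_clause_set[OF F], of l] v l by simp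
  moreover have "1 \<le> ld F l" "1 \<le> ld F (complement l)"
    using MU_ld_pos[OF F, of l] MU_ld_pos[OF F, of "complement l"] v l by auto
  ultimately have "ld F l = 1" "ld F (complement l) = 1" by auto
  then obtain C D where "{E \<in> F. l \<in> E} = {C}" "{E \<in> F. complement l \<in> E} = {D}"
    unfolding ld_def by (meson card_1_singletonE)
  then show ?thesis by (intro that[of C D]) auto
qed

section \<open>Resolving away a variable of degree two (Davis-Putnam elimination)\<close>

definition resolve :: "'v literal set set \<Rightarrow> 'v literal \<Rightarrow> 'v literal set \<Rightarrow> 'v literal set \<Rightarrow> 'v literal set set"
  where "resolve F l C D = insert ((C - {l}) \<union> (D - {complement l})) (F - {C, D})"

context
  fixes F :: "'v literal set set" and l C D
  assumes F: "F \<in> MU" and C: "C \<in> F" "l \<in> C" and D: "D \<in> F" "complement l \<in> D"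
    and onlyC: "\<forall>E\<in>F. l \<in> E \<longrightarrow> E = C" and onlyD: "\<forall>E\<in>F. complement l \<in> E \<longrightarrow> E = D"
begin

private lemma C_D: "l \<notin> D" "complement l \<notin> C" "C \<noteq> D"
  using C D clause_setD(3)[OF MU_clause_set[OF F]] complement_complement by metis+

private lemma other: "E \<in> F - {C, D} \<Longrightarrow> x \<in> E \<Longrightarrow> lit_var x \<noteq> lit_var l"
  using onlyC onlyD unfolding lit_var_eq_iff by blast

private lemma extend_model:
  assumes "models \<phi> (F - {C, D})" "\<exists>x\<in>(C - {l}) \<union> (D - {complement l}). lit_true \<phi> x"
  shows "\<exists>\<psi>. models \<psi> F"
proof -
  \<comment> \<open>\<open>E\<close> is the parent that \<open>\<phi>\<close> satisfies off the
    resolved variable; \<open>m\<close> is the literal of that variable satisfying the other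
    parent.\<close>
  obtain m E where m: "(m = l \<and> E = D) \<or> (m = complement l \<and> E = C)"
    "\<exists>x\<in>E - {complement m}. lit_true \<phi> x"
    using assms(2) complement_complement by (metis UnE)
  have vm: "lit_var m = lit_var l" using m(1) by auto
  have "\<exists>x\<in>A. lit_true (set_true m \<phi>) x" if "A \<in> F" for A
  proof (cases "m \<in> A")
    case True then show ?thesis using set_true_self by blast
  next
    case False
    then have "A = E \<or> A \<in> F - {C, D}" using m(1) that C D by blast
    then show ?thesis
    proof
      assume "A = E" then show ?thesis using m(2) set_true_mono by blast
    next
      assume A: "A \<in> F - {C, D}"
      then obtain x where "x \<in> A" "lit_true \<phi> x" using assms(1) unfolding models_def by blast
      moreover have "lit_var x \<noteq> lit_var m" using other[OF A \<open>x \<in> A\<close>] vm by simp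
      ultimately show ?thesis using set_true_other by blast
    qed
  qed
  then show ?thesis unfolding models_def by blast
qed

private lemma remove_two: "\<exists>\<phi>. models \<phi> (F - {C, D})"
proof -
  obtain \<phi> where "models \<phi> (F - {C})" using MU_remove[OF F C(1)] by blast
  then have "models \<phi> (F - {C, D})" by (rule models_mono) blast
  then show ?thesis by blast
qed

text \<open>A second clash would make the resolvent a tautology, so every model of the remaining
  clauses would extend to a model of \<open>F\<close>.\<close>

lemma resolve_no_clash:
  assumes x: "x \<in> C" "complement x \<in> D"
  shows "x = l"
proof (rule ccontr)
  assume "x \<noteq> l"
  then have "x \<in> C - {l}" "complement x \<in> D - {complement l}" using x by auto
  then have "\<exists>y\<in>(C - {l}) \<union> (D - {complement l}). lit_true \<phi> y" for \<phi>
    using lit_true_complement by blast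
  then show False using extend_model remove_two MU_unsat[OF F] by blast
qed

text \<open>A model of the other clauses would satisfy a resolvent among them and so extend to
  \<open>F\<close>. Thus resolving costs exactly one clause and one variable, which keeps the
  deficiency.\<close>

lemma resolvent_new: "(C - {l}) \<union> (D - {complement l}) \<notin> F - {C, D}"
proof
  assume a: "(C - {l}) \<union> (D - {complement l}) \<in> F - {C, D}"
  obtain \<phi> where \<phi>: "models \<phi> (F - {C, D})" using remove_two by blast
  have "\<exists>x\<in>(C - {l}) \<union> (D - {complement l}). lit_true \<phi> x" using \<phi> a unfolding models_def by (rule bspec)
  then show False using extend_model[OF \<phi>] MU_unsat[OF F] by blast
qed

lemma resolve_MU: "resolve F l C D \<in> MU"
  unfolding MU_iff
proof (intro conjI allI ballI)
  let ?R = "(C - {l}) \<union> (D - {complement l})"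
  have cs: "is_clause_set F" by (rule MU_clause_set[OF F])
  have "complement x \<notin> ?R" if "x \<in> ?R" for x
  proof
    assume y: "complement x \<in> ?R"
    have "\<not> (x \<in> C \<and> complement x \<in> C)" "\<not> (x \<in> D \<and> complement x \<in> D)"
      using clause_setD(3)[OF cs] C D by blast+
    then have "(x \<in> C - {l} \<and> complement x \<in> D) \<or> (complement x \<in> C - {l} \<and> complement (complement x) \<in> D)"
      using that y by auto
    then show False using resolve_no_clash by blast
  qed
  moreover have "finite ?R" using clause_setD(2)[OF cs] C D by blast
  ultimately have "is_clause ?R" unfolding is_clause_def by blast
  then show "is_clause_set (resolve F l C D)"
    using cs unfolding resolve_def is_clause_set_def by blast
  show "\<not> models \<phi> (resolve F l C D)" for \<phi>
  proof
    assume m: "models \<phi> (resolve F l C D)"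
    have "models \<phi> (F - {C, D})" using m by (rule models_mono) (auto simp: resolve_def)
    moreover have "\<exists>x\<in>?R. lit_true \<phi> x" using m unfolding models_def resolve_def by blast
    ultimately show False using extend_model MU_unsat[OF F] by blast
  qed
  fix E assume E: "E \<in> resolve F l C D"
  show "\<exists>\<phi>. models \<phi> (resolve F l C D - {E})"
  proof (cases "E = ?R")
    case True
    then have "resolve F l C D - {E} \<subseteq> F - {C, D}" unfolding resolve_def by blast
    then show ?thesis using remove_two models_mono by blast
  next
    case False
    then have E: "E \<in> F" "E \<noteq> C" "E \<noteq> D" using E unfolding resolve_def by blast+
    obtain \<phi> where \<phi>: "models \<phi> (F - {E})" using MU_remove[OF F E(1)] by blast
    have "C \<in> F - {E}" "D \<in> F - {E}" using C D E by auto
    then obtain x y where xy: "x \<in> C" "lit_true \<phi> x" "y \<in> D" "lit_true \<phi> y"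
      using \<phi> unfolding models_def by meson
    have "x \<noteq> l \<or> y \<noteq> complement l" using xy by auto
    then have "\<exists>x\<in>?R. lit_true \<phi> x" using xy by blast
    moreover have "models \<phi> (F - {C, D} - {E})" using \<phi> by (rule models_mono) blast
    ultimately have "models \<phi> (resolve F l C D - {E})" unfolding resolve_def models_def by blast
    then show ?thesis by blast
  qed
qed

lemma cs_vars_resolve: "cs_vars (resolve F l C D) = cs_vars F - {lit_var l}"
proof
  show "cs_vars (resolve F l C D) \<subseteq> cs_vars F - {lit_var l}"
  proof
    fix v assume "v \<in> cs_vars (resolve F l C D)"
    then obtain E x where E: "E \<in> resolve F l C D" "x \<in> E" "lit_var x = v" by (rule cs_varsE)
    have "lit_var x \<noteq> lit_var l \<and> (\<exists>E'\<in>F. x \<in> E')"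
    proof (cases "E \<in> F - {C, D}")
      case True then show ?thesis using other[OF True E(2)] E(2) by blast
    next
      case False
      then have "E = (C - {l}) \<union> (D - {complement l})" using E(1) unfolding resolve_def by blast
      then have "x \<in> C - {l} \<or> x \<in> D - {complement l}" using E(2) by blast
      then have "x \<noteq> l \<and> x \<noteq> complement l" "x \<in> C \<or> x \<in> D" using C_D by auto
      then show ?thesis using C(1) D(1) unfolding lit_var_eq_iff by blast
    qed
    then show "v \<in> cs_vars F - {lit_var l}" using in_cs_vars[of _ F x] unfolding E(3) by blast
  qed
  show "cs_vars F - {lit_var l} \<subseteq> cs_vars (resolve F l C D)"
  proof
    fix v assume v: "v \<in> cs_vars F - {lit_var l}"
    then have "v \<in> cs_vars F" by blast
    then obtain E x where E: "E \<in> F" "x \<in> E" "lit_var x = v" by (rule cs_varsE)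
    have "lit_var x \<noteq> lit_var l" using v E(3) by simp
    then have "x \<noteq> l" "x \<noteq> complement l" unfolding lit_var_eq_iff by simp_all
    have "\<exists>E'\<in>resolve F l C D. x \<in> E'"
    proof (cases "E \<in> F - {C, D}")
      case True
      then show ?thesis using E(2) unfolding resolve_def by blast
    next
      case False
      then have "x \<in> (C - {l}) \<union> (D - {complement l})"
        using E(1,2) \<open>x \<noteq> l\<close> \<open>x \<noteq> complement l\<close> by auto
      then show ?thesis unfolding resolve_def by (rule bexI[OF _ insertI1])
    qed
    then show "v \<in> cs_vars (resolve F l C D)" using in_cs_vars[of _ _ x] unfolding E(3) by blast
  qed
qed

lemma deficiency_resolve: "deficiency (resolve F l C D) = deficiency F"
proof -
  have fin: "finite F" "finite (cs_vars F)" using MU_finite[OF F] finite_cs_vars[OF MU_clause_set[OF F]] by auto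
  have "card (resolve F l C D) = Suc (card (F - {C, D}))"
    unfolding resolve_def using resolvent_new fin by simp
  moreover have "card F = card (F - {C, D}) + 2"
    using C D C_D fin card_Diff_subset[of "{C, D}" F] card_mono[of F "{C, D}"] by simp
  moreover have "card (cs_vars F) = Suc (card (cs_vars (resolve F l C D)))"
    using cs_vars_resolve fin in_cs_vars[OF C] by (metis card_Suc_Diff1)
  ultimately show ?thesis by (simp add: deficiency_def num_clauses_def num_vars_def)
qed

lemma var_degree_resolve:
  assumes z: "z \<noteq> lit_var l" "z \<notin> clause_vars ((C - {l}) \<union> (D - {complement l}))"
  shows "var_degree (resolve F l C D) z = var_degree F z"
proof -
  let ?R = "(C - {l}) \<union> (D - {complement l})"
  have "C \<subseteq> insert l ?R" "D \<subseteq> insert (complement l) ?R" by blast+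
  then have "clause_vars C \<subseteq> insert (lit_var l) (clause_vars ?R)"
    "clause_vars D \<subseteq> insert (lit_var l) (clause_vars ?R)"
    unfolding clause_vars_def by force+
  then have "z \<notin> clause_vars C" "z \<notin> clause_vars D" using z by blast+
  then have "{E \<in> resolve F l C D. z \<in> clause_vars E} = {E \<in> F. z \<in> clause_vars E}"
    using z(2) unfolding resolve_def by blast
  then show ?thesis by (simp add: var_degree_def)
qed

end

text \<open>Resolving away a variable of degree two carries the clashes into a smaller clause-set,
  unless the two clauses are the parents themselves, where \<open>resolve_no_clash\<close>
  decides.\<close>

lemma MU1_clash_unique:
  assumes "F \<in> MU" "deficiency F = 1" "E1 \<in> F" "E2 \<in> F"
    "x \<in> E1" "complement x \<in> E2" "y \<in> E1" "complement y \<in> E2"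
  shows "x = y"
  using assms
proof (induction "card (cs_vars F)" arbitrary: F E1 E2 rule: less_induct)
  case less
  note F = less.prems(1)
  have "cs_vars F \<noteq> {}" using in_cs_vars less.prems(3,5) by blast
  then obtain v where v: "v \<in> cs_vars F" "var_degree F v = 2" using MU1_degree_two[OF F less.prems(2)] by blast
  obtain l where lv: "lit_var l = v" using lit_var.simps(1)[of v] by blast
  obtain C D where CD: "C \<in> F" "l \<in> C" "D \<in> F" "complement l \<in> D"
    "\<forall>E\<in>F. l \<in> E \<longrightarrow> E = C" "\<forall>E\<in>F. complement l \<in> E \<longrightarrow> E = D"
    by (rule degree_two_clauses[OF F v lv])
  note ctx = F CD
  let ?R = "(C - {l}) \<union> (D - {complement l})"
  show ?case
  proof (cases "{E1, E2} = {C, D}")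
    case True
    then consider "E1 = C" "E2 = D" | "E1 = D" "E2 = C" by (auto simp: doubleton_eq_iff)
    then show ?thesis
    proof cases
      case 1
      then show ?thesis using resolve_no_clash[OF ctx] less.prems by blast
    next
      case 2
      then have "complement x = l" "complement y = l"
        using resolve_no_clash[OF ctx] less.prems complement_complement by metis+
      then show ?thesis by (metis complement_complement)
    qed
  next
    case False
    \<comment> \<open>\<open>r\<close> sends both parents to the resolvent. A clash on the resolved
      variable would force \<open>{E1, E2} = {C, D}\<close>, so the clashing literals
      survive.\<close>
    define r where "r E = (if E = C \<or> E = D then ?R else E)" for E
    have nv: "lit_var z \<noteq> lit_var l" if z: "z \<in> E1" "complement z \<in> E2" for z
    proof
      assume "lit_var z = lit_var l"
      then have "z = l \<or> z = complement l" by (simp add: lit_var_eq_iff)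
      then show False
      proof
        assume "z = l"
        then have "E1 = C" "E2 = D" using z CD(5,6) less.prems by blast+
        then show False using False by blast
      next
        assume "z = complement l"
        then have "E1 = D" "E2 = C" using z CD(5,6) less.prems by auto
        then show False using False by blast
      qed
    qed
    have r: "z \<in> r E" if "z \<in> E" "lit_var z \<noteq> lit_var l" for z E
      using that unfolding r_def by auto
    have rF: "r E \<in> resolve F l C D" if "E \<in> F" for E
      using that unfolding r_def resolve_def by auto
    have "card (cs_vars (resolve F l C D)) < card (cs_vars F)"
      unfolding cs_vars_resolve[OF ctx] using v lv finite_cs_vars[OF MU_clause_set[OF F]]
      by (intro card_Diff1_less) auto
    moreover have "deficiency (resolve F l C D) = 1" using deficiency_resolve[OF ctx] less.prems by simp
    ultimately show ?thesis
      using less.hyps[of "resolve F l C D" "r E1" "r E2"] resolve_MU[OF ctx] rF r nv less.prems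
      by (metis lit_var_complement)
  qed
qed

text \<open>
  The clause-sets of deficiency 1 come from binary trees labelled with pairwise distinct variables:
  either the root has a leaf as a child, or there are two inner nodes both of whose children are leaves.
\<close>

lemma MU1_separated_pair:
  assumes "F \<in> MU" "deficiency F = 1" "cs_vars F \<noteq> {}" "\<And>l. {l} \<notin> F"
  shows "\<exists>z1 z2. z1 \<in> cs_vars F \<and> z2 \<in> cs_vars F \<and> z1 \<noteq> z2 \<and> var_degree F z1 = 2 \<and> var_degree F z2 = 2 \<and>
    (\<forall>E\<in>F. \<not> (z1 \<in> clause_vars E \<and> z2 \<in> clause_vars E))"
  using assms
proof (induction "card (cs_vars F)" arbitrary: F rule: less_induct)
  case less
  note F = less.prems(1)
  obtain v where v: "v \<in> cs_vars F" "var_degree F v = 2" using MU1_degree_two[OF F less.prems(2)] less.prems(3) by blast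
  obtain l where lv: "lit_var l = v" using lit_var.simps(1)[of v] by blast
  obtain C D where CD: "C \<in> F" "l \<in> C" "D \<in> F" "complement l \<in> D"
    "\<forall>E\<in>F. l \<in> E \<longrightarrow> E = C" "\<forall>E\<in>F. complement l \<in> E \<longrightarrow> E = D"
    by (rule degree_two_clauses[OF F v lv])
  note ctx = F CD
  define R where "R = (C - {l}) \<union> (D - {complement l})"
  define F' where "F' = resolve F l C D"
  have F': "F' \<in> MU" "deficiency F' = 1" "cs_vars F' = cs_vars F - {v}"
    unfolding F'_def using resolve_MU[OF ctx] deficiency_resolve[OF ctx] cs_vars_resolve[OF ctx] less.prems lv by auto
  have R: "R \<in> F'" unfolding F'_def R_def resolve_def by blast
  have deg: "var_degree F' z = var_degree F z" if "z \<noteq> v" "z \<notin> clause_vars R" for z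
    using var_degree_resolve[OF ctx] that lv unfolding F'_def R_def by blast
  have v_occ: "E = C \<or> E = D" if "E \<in> F" "v \<in> clause_vars E" for E
    using that CD(5,6) lv in_clause_vars_iff by metis
  have CDR: "z \<in> clause_vars R" if "z \<in> clause_vars C \<or> z \<in> clause_vars D" "z \<noteq> v" for z
    using that lv unfolding R_def clause_vars_def by auto
  \<comment> \<open>The clauses through \<open>v\<close> are \<open>C\<close> and \<open>D\<close>,
    whose other variables all lie in \<open>R\<close>; so \<open>v\<close> is separated from every
    variable missing in \<open>R\<close>.\<close>
  have with_v: ?case if z: "z \<in> cs_vars F'" "var_degree F' z = 2" "z \<notin> clause_vars R" for z
  proof -
    have "z \<noteq> v" "z \<in> cs_vars F" using z F' by auto
    moreover have "\<forall>E\<in>F. \<not> (v \<in> clause_vars E \<and> z \<in> clause_vars E)"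
      using v_occ CDR \<open>z \<noteq> v\<close> z(3) by blast
    ultimately show ?case using v z deg by metis
  qed
  have ne: "cs_vars F' \<noteq> {}"
  proof
    assume "cs_vars F' = {}"
    then have "R = {}" using R F' MU_no_vars by blast
    then have "C = {l}" using CD(2) unfolding R_def by blast
    then show False using less.prems(4) CD(1) by blast
  qed
  have less': "card (cs_vars F') < card (cs_vars F)"
    unfolding F'(3) using v finite_cs_vars[OF MU_clause_set[OF F]] by (intro card_Diff1_less) auto
  show ?case
  proof (cases "\<exists>m. {m} \<in> F'")
    case False
    then obtain z1 z2 where z: "z1 \<in> cs_vars F'" "z2 \<in> cs_vars F'" "z1 \<noteq> z2" "var_degree F' z1 = 2" "var_degree F' z2 = 2"
      "\<forall>E\<in>F'. \<not> (z1 \<in> clause_vars E \<and> z2 \<in> clause_vars E)"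
      using less.hyps[OF less' F'(1,2) ne] by blast
    then have "z1 \<notin> clause_vars R \<or> z2 \<notin> clause_vars R" using R by blast
    then show ?thesis using with_v z by blast
  next
    case True
    then obtain m where m: "{m} \<in> F'" ..
    have "{m} \<notin> F" using less.prems(4) by blast
    \<comment> \<open>\<open>F\<close> has no unit clause, so the one in \<open>F'\<close> is the
      resolvent. Any variable of degree two left after propagating it is missing in
      \<open>R\<close>.\<close>
    then have Rm: "R = {m}" using m unfolding F'_def resolve_def R_def by blast
    note u = unit_propagation[OF F'(1) m]
    \<comment> \<open>Otherwise \<open>complement m\<close> would occur in \<open>F'\<close> only as
      \<open>{complement m}\<close>, a unit clause of \<open>F\<close>.\<close>
    have vars: "cs_vars (assign F' m) \<noteq> {}"
    proof
      assume "cs_vars (assign F' m) = {}"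
      then have "cs_vars F' = {lit_var m}" using u(2) ne by blast
      moreover have "lit_var (complement m) \<in> cs_vars F'" using m in_cs_vars by fastforce
      then obtain E where E: "E \<in> F'" "complement m \<in> E" using MU_literal_occurs[OF F'(1)] by blast
      moreover have "m \<notin> E" using E clause_setD(3)[OF MU_clause_set[OF F'(1)]] by blast
      ultimately have "E \<subseteq> {complement m}"
        using in_cs_vars lit_var_eq_iff by (metis insertCI singletonD subsetI)
      then have "E = {complement m}" using E by blast
      moreover have "E \<noteq> R" using E Rm \<open>m \<notin> E\<close> by blast
      ultimately have "{complement m} \<in> F" using E unfolding F'_def resolve_def R_def by blast
      then show False using less.prems(4) by blast
    qed
    obtain z where z: "z \<in> cs_vars (assign F' m)" "var_degree (assign F' m) z = 2"
      using MU1_degree_two[OF u(1) _ vars] u(4) F'(2) by auto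
    then have "z \<in> cs_vars F'" "z \<noteq> lit_var m" using u(2) by auto
    then show ?thesis using with_v[of z] u(6)[of z] z Rm by (simp add: clause_vars_def)
  qed
qed


section \<open>Deficiency two, degrees at least four, no unit clauses\<close>

definition assigns :: "'v literal set set \<Rightarrow> 'v literal set \<Rightarrow> 'v literal set set" where
  "assigns F L = (\<lambda>C. C - complement ` L) ` {C \<in> F. C \<inter> L = {}}"

lemma assigns_single: "assigns F {l} = assign F l"
  by (auto simp: assigns_def assign_def)

lemma assigns_insert:
  assumes "lit_var l \<notin> lit_var ` L"
  shows "assigns F (insert l L) = assign (assigns F L) l"
proof -
  have l: "l \<notin> L" "l \<notin> complement ` L" "complement l \<notin> L"
    using assms image_eqI[of "lit_var l" lit_var "complement l" L] by force+
  have 1: "C \<inter> insert l L = {} \<longleftrightarrow> C \<inter> L = {} \<and> l \<notin> C - complement ` L" for C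
    using l by blast
  have 2: "C - complement ` insert l L = (C - complement ` L) - {complement l}" for C
    by blast
  show ?thesis
    unfolding assigns_def assign_def 1 2 by blast
qed

text \<open>A saturated extension of what remains in the deficiency-six case after setting a literal
  with five occurrences. The aim is degree exactly 4 everywhere.\<close>

locale saturated_def2 =
  fixes G :: "'v literal set set"
  assumes sat: "saturated G" and def2: "deficiency G = 2"
    and deg4: "\<And>v. v \<in> cs_vars G \<Longrightarrow> 4 \<le> var_degree G v"
    and no_unit: "\<And>l. {l} \<notin> G"
begin

lemma in_MU: "G \<in> MU"
  using sat by (rule saturated_MU)

context
  fixes l
  assumes l: "lit_var l \<in> cs_vars G" "var_degree G (lit_var l) = 4"
begin

lemma min_l: "w \<in> cs_vars G \<Longrightarrow> var_degree G (lit_var l) \<le> var_degree G w"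
  using deg4 l by simp

text \<open>Each of the two literals occurs at most \<open>deficiency G = 2\<close> times, and
  together they occur four times.\<close>

lemma ld_two: "ld G l = 2"
proof -
  have a: "int (ld G l) \<le> 2" using ld_le_deficiency[OF sat l(1) min_l] def2 by simp
  have c: "lit_var (complement l) \<in> cs_vars G" using l(1) by simp
  have "var_degree G (lit_var (complement l)) \<le> var_degree G w" if "w \<in> cs_vars G" for w
    using min_l[OF that] by simp
  then have b: "int (ld G (complement l)) \<le> 2" using ld_le_deficiency[OF sat c] def2 by simp
  have "ld G l + ld G (complement l) = 4" using var_degree_eq_ld[OF MU_clause_set[OF in_MU], of l] l by simp
  then show ?thesis using a b by simp
qed

lemma assign_props:
  "assign G l \<in> MU" "cs_vars (assign G l) = cs_vars G - {lit_var l}" "deficiency (assign G l) = 1"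
  using split_min_degree(1,2,3)[OF sat l(1) min_l] def2 ld_two by simp_all

end

lemma assign_vars_ne:
  assumes l: "lit_var l \<in> cs_vars G" "var_degree G (lit_var l) = 4"
  shows "cs_vars (assign G l) \<noteq> {}"
  using assign_cs_vars_ne[OF in_MU assign_props(1)[OF l]] ld_two[of "complement l"] l by simp

text \<open>The degree of \<open>x\<close> drops from at least 4 to 2 and only two clauses contain
  \<open>l\<close>, so both contain \<open>x\<close>. Each literal of \<open>x\<close> drops from
  two occurrences to one, so the two clauses carry opposite literals of \<open>x\<close>.\<close>

lemma degree_two_in_assign:
  assumes l: "lit_var l \<in> cs_vars G" "var_degree G (lit_var l) = 4"
    and x: "x \<in> cs_vars (assign G l)" "var_degree (assign G l) x = 2"
  shows "var_degree G x = 4" "x \<in> cs_vars G" "x \<noteq> lit_var l"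
    and "\<And>C. C \<in> G \<Longrightarrow> l \<in> C \<Longrightarrow> x \<in> clause_vars C"
    and "\<And>y. lit_var y = x \<Longrightarrow> card {C \<in> G. l \<in> C \<and> y \<in> C} = 1"
proof -
  note p = assign_props[OF l]
  show xG: "x \<in> cs_vars G" and ne: "x \<noteq> lit_var l" using x p(2) by auto
  have fin: "finite {C \<in> G. l \<in> C}" using MU_finite[OF in_MU] by simp
  have two: "card {C \<in> G. l \<in> C} = 2" using ld_two[OF l] by (simp add: ld_def)
  have sub: "{C \<in> G. l \<in> C \<and> x \<in> clause_vars C} \<subseteq> {C \<in> G. l \<in> C}" by blast
  have "4 \<le> 2 + card {C \<in> G. l \<in> C \<and> x \<in> clause_vars C}"
    using var_degree_assign[OF in_MU ne] x(2) deg4[OF xG] by simp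
  moreover have "card {C \<in> G. l \<in> C \<and> x \<in> clause_vars C} \<le> 2"
    using card_mono[OF fin sub] two by simp
  ultimately have c: "card {C \<in> G. l \<in> C \<and> x \<in> clause_vars C} = 2" by simp
  then show d: "var_degree G x = 4" using var_degree_assign[OF in_MU ne] x(2) by simp
  have "{C \<in> G. l \<in> C \<and> x \<in> clause_vars C} = {C \<in> G. l \<in> C}"
    using card_subset_eq[OF fin sub] c two by simp
  then show "x \<in> clause_vars C" if "C \<in> G" "l \<in> C" for C using that by blast
  show "card {C \<in> G. l \<in> C \<and> y \<in> C} = 1" if y: "lit_var y = x" for y
  proof -
    have "ld (assign G l) y = 1"
    proof -
      have "ld (assign G l) y + ld (assign G l) (complement y) = 2"
        using var_degree_eq_ld[OF MU_clause_set[OF p(1)], of y] y x by simp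
      moreover have "1 \<le> ld (assign G l) y" "1 \<le> ld (assign G l) (complement y)"
        using MU_ld_pos[OF p(1), of y] MU_ld_pos[OF p(1), of "complement y"] y x by auto
      ultimately show ?thesis by simp
    qed
    moreover have "ld G y = 2" using ld_two[of y] y xG d by simp
    ultimately show ?thesis using ld_assign[OF in_MU, of y l] y ne by simp
  qed
qed

text \<open>The two clauses through \<open>l\<close> clash on each such variable. Without
  \<open>l\<close> they are clauses of the opposite split, which has deficiency 1, where two clauses
  clash at most once.\<close>

lemma degree_two_unique:
  assumes l: "lit_var l \<in> cs_vars G" "var_degree G (lit_var l) = 4"
    and x: "x \<in> cs_vars (assign G l)" "var_degree (assign G l) x = 2"
    and y: "y \<in> cs_vars (assign G l)" "var_degree (assign G l) y = 2"
  shows "x = y"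
proof -
  let ?B = "assign G (complement l)"
  have l': "lit_var (complement l) \<in> cs_vars G" "var_degree G (lit_var (complement l)) = 4"
    using l by simp_all
  have "card {C \<in> G. l \<in> C} = 2" using ld_two[OF l] by (simp add: ld_def)
  then obtain N1 N2 where N: "{C \<in> G. l \<in> C} = {N1, N2}" "N1 \<noteq> N2" by (meson card_2_iff)
  have NG: "N1 \<in> G" "N2 \<in> G" "l \<in> N1" "l \<in> N2" using N by blast+
  have clash: "\<exists>m. lit_var m = z \<and> m \<in> N1 - {l} \<and> complement m \<in> N2 - {l}"
    if z: "z \<in> cs_vars (assign G l)" "var_degree (assign G l) z = 2" for z
  proof -
    note dz = degree_two_in_assign[OF l z]
    have "z \<in> clause_vars N1" "z \<in> clause_vars N2" using dz(4) NG by blast+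
    then obtain m m2 where m: "m \<in> N1" "lit_var m = z" "m2 \<in> N2" "lit_var m2 = z"
      by (auto simp: clause_vars_def)
    have "m2 \<noteq> m"
    proof
      assume "m2 = m"
      then have "{C \<in> G. l \<in> C \<and> m \<in> C} \<supseteq> {N1, N2}" using NG m by blast
      then have "2 \<le> card {C \<in> G. l \<in> C \<and> m \<in> C}"
        using N(2) card_mono[of "{C \<in> G. l \<in> C \<and> m \<in> C}" "{N1, N2}"] MU_finite[OF in_MU] by simp
      then show False using dz(5)[OF m(2)] by simp
    qed
    then have "m2 = complement m" using m lit_var_eq_iff by metis
    moreover have "m \<noteq> l" "m2 \<noteq> l" using m dz(3) by auto
    ultimately show ?thesis using m by blast
  qed
  obtain m where m: "lit_var m = x" "m \<in> N1 - {l}" "complement m \<in> N2 - {l}" using clash[OF x] by blast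
  obtain n where n: "lit_var n = y" "n \<in> N1 - {l}" "complement n \<in> N2 - {l}" using clash[OF y] by blast
  have NB: "N - {l} \<in> ?B" if "N \<in> G" "l \<in> N" for N
    using that clause_setD(3)[OF MU_clause_set[OF in_MU] that] by (auto simp: assign_def)
  have "m = n"
    by (rule MU1_clash_unique[OF assign_props(1,3)[OF l'] NB[OF NG(1,3)] NB[OF NG(2,4)]]) (use m n in auto)
  then show ?thesis using m n by blast
qed

text \<open>By uniqueness there is no separated pair in \<open>assign G l\<close>, so it has a unit
  clause, which stems from some \<open>{complement l, m}\<close>. The degree-two variable of the
  opposite split lies in every clause through \<open>complement l\<close>, hence is that of
  \<open>m\<close>.\<close>

lemma binary_clause:
  assumes l: "lit_var l \<in> cs_vars G" "var_degree G (lit_var l) = 4"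
  shows "\<exists>m. {complement l, m} \<in> G \<and> lit_var m \<in> cs_vars G \<and> lit_var m \<noteq> lit_var l \<and>
    var_degree G (lit_var m) = 4 \<and> (\<forall>C\<in>G. complement l \<in> C \<longrightarrow> lit_var m \<in> clause_vars C) \<and>
    (\<forall>x\<in>cs_vars (assign G (complement l)). var_degree (assign G (complement l)) x = 2 \<longrightarrow> x = lit_var m)"
proof -
  note p = assign_props[OF l]
  have "\<exists>m. {m} \<in> assign G l"
  proof (rule ccontr)
    assume "\<not> ?thesis"
    then have "\<And>m. {m} \<notin> assign G l" by blast
    from MU1_separated_pair[OF p(1,3) assign_vars_ne[OF l] this]
    show False using degree_two_unique[OF l] by blast
  qed
  then obtain m where "{m} \<in> assign G l" ..
  then obtain C where C: "C \<in> G" "l \<notin> C" "C - {complement l} = {m}" by (auto simp: assign_def)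
  then have "C = {m} \<or> C = {complement l, m}" by blast
  then have bin: "{complement l, m} \<in> G" using no_unit C by blast
  have ml: "lit_var m \<noteq> lit_var l"
    using C unfolding lit_var_eq_iff by blast
  have l': "lit_var (complement l) \<in> cs_vars G" "var_degree G (lit_var (complement l)) = 4"
    using l by simp_all
  note p' = assign_props[OF l']
  obtain x where x: "x \<in> cs_vars (assign G (complement l))" "var_degree (assign G (complement l)) x = 2"
    using MU1_degree_two[OF p'(1,3) assign_vars_ne[OF l']] by blast
  note d = degree_two_in_assign[OF l' x]
  have "x \<in> clause_vars {complement l, m}" using d(4)[OF bin] by simp
  then have xm: "x = lit_var m" using d(3) by (auto simp: clause_vars_def)
  show ?thesis
    using bin ml d(1,2,4) degree_two_unique[OF l' x] xm by (intro exI[of _ m]) auto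
qed

text \<open>
  A maximal set \<open>L\<close> of literals on variables of degree 4, reached by unit propagation in \<open>A\<close>, reduces \<open>A\<close>
  to a clause-set \<open>S\<close> and satisfies exactly \<open>|L|\<close> clauses of \<open>A\<close>. If \<open>S\<close> still had variables, then every
  \<open>m \<in> L\<close> would lie in an implication \<open>m \<longrightarrow> m'\<close> with \<open>m' \<in> L\<close>; these \<open>|L|\<close> binary clauses and the unit
  clause \<open>{a}\<close> are too many.
\<close>

lemma all_degree_four:
  assumes v: "v \<in> cs_vars G"
  shows "var_degree G v = 4"
proof -
  have "\<exists>w\<in>cs_vars G. var_degree G w = 4"
  proof (rule ccontr)
    assume "\<not> ?thesis"
    then have "5 \<le> var_degree G w" if "w \<in> cs_vars G" for w using deg4[OF that] that by fastforce
    \<comment> \<open>Minimum degree 5 has \<open>q = 2\<close> and would need deficiency 3.\<close>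
    then show False using MU_degree_bound[OF in_MU, of 5 2] v def2 by auto
  qed
  then obtain w where w: "w \<in> cs_vars G" "var_degree G w = 4" by blast
  define l where "l = Pos w"
  have l: "lit_var l \<in> cs_vars G" "var_degree G (lit_var l) = 4" using w by (simp_all add: l_def)
  have l': "lit_var (complement l) \<in> cs_vars G" "var_degree G (lit_var (complement l)) = 4"
    using l by simp_all
  define A where "A = assign G l"
  note p = assign_props[OF l, folded A_def]
  obtain a where a: "{complement l, a} \<in> G" "lit_var a \<in> cs_vars G" "lit_var a \<noteq> lit_var l"
    "var_degree G (lit_var a) = 4" "\<forall>C\<in>G. complement l \<in> C \<longrightarrow> lit_var a \<in> clause_vars C"
    using binary_clause[OF l] by blast
  obtain b where b: "lit_var b \<noteq> lit_var l" "\<forall>C\<in>G. l \<in> C \<longrightarrow> lit_var b \<in> clause_vars C"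
    "\<forall>x\<in>cs_vars A. var_degree A x = 2 \<longrightarrow> x = lit_var b"
    using binary_clause[OF l'] unfolding A_def by auto
  have aA: "{a} \<in> A"
  proof -
    have "a \<noteq> l" "a \<noteq> complement l" using a(3) by auto
    then have "l \<notin> {complement l, a}" "{complement l, a} - {complement l} = {a}" by auto
    then show ?thesis unfolding A_def assign_def using a(1) by (intro image_eqI[of _ _ "{complement l, a}"]) auto
  qed
  \<comment> \<open>Each propagation removes exactly one clause, whence the count, and keeps the
    other degrees, so a variable of degree two in the rest has degree two in \<open>A\<close> and
    must be that of \<open>b\<close>.\<close>
  define inv where "inv L \<longleftrightarrow> finite L \<and> a \<in> L \<and> (\<forall>m\<in>L. complement m \<notin> L) \<and>
    (\<forall>m\<in>L. lit_var m \<in> cs_vars G \<and> lit_var m \<noteq> lit_var l \<and> var_degree G (lit_var m) = 4) \<and>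
    assigns A L \<in> MU \<and> deficiency (assigns A L) = 1 \<and>
    cs_vars (assigns A L) = cs_vars A - lit_var ` L \<and>
    card (assigns A L) + card L = card A \<and>
    (\<forall>z\<in>cs_vars (assigns A L). var_degree (assigns A L) z = var_degree A z)" for L
  have cardS: "1 \<le> card S" if "S \<in> MU" for S :: "'v literal set set"
    using MU_nonempty[OF that] MU_finite[OF that] by (simp add: Suc_le_eq card_gt_0_iff)
  have inv0: "inv {a}"
    using unit_propagation[OF p(1) aA] a p(3) cardS[OF p(1)]
    unfolding inv_def assigns_single by auto
  have step: "inv (insert m L)" "card (insert m L) = Suc (card L)"
    if L: "inv L" and m: "{m} \<in> assigns A L" "var_degree G (lit_var m) = 4" for L m
  proof -
    have S: "assigns A L \<in> MU" "cs_vars (assigns A L) = cs_vars A - lit_var ` L" using L by (auto simp: inv_def)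
    have mv: "lit_var m \<in> cs_vars A - lit_var ` L" using in_cs_vars[OF m(1)] S(2) by simp
    then have new: "lit_var m \<notin> lit_var ` L" by blast
    then have mL: "m \<notin> L" "complement m \<notin> L"
      using image_eqI[of "lit_var m" lit_var "complement m" L] by force+
    have fin: "finite L" using L by (simp add: inv_def)
    then show "card (insert m L) = Suc (card L)" using mL by simp
    have mG: "lit_var m \<in> cs_vars G" "lit_var m \<noteq> lit_var l" using mv p(2) by auto
    note u = unit_propagation[OF S(1) m(1), folded assigns_insert[OF new]]
    have "complement m' \<noteq> m" if "m' \<in> L" for m' using that mL by auto
    then have cons: "\<forall>m'\<in>insert m L. complement m' \<notin> insert m L"
      using L mL unfolding inv_def by auto
    have vs: "cs_vars (assigns A (insert m L)) = cs_vars A - lit_var ` insert m L"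
      using u(2) S(2) by auto
    have dg: "\<forall>z\<in>cs_vars (assigns A (insert m L)). var_degree (assigns A (insert m L)) z = var_degree A z"
    proof
      fix z assume z: "z \<in> cs_vars (assigns A (insert m L))"
      then have "z \<noteq> lit_var m" "z \<in> cs_vars (assigns A L)" using u(2) by auto
      then show "var_degree (assigns A (insert m L)) z = var_degree A z"
        using u(6) L unfolding inv_def by metis
    qed
    have cd: "card (assigns A (insert m L)) + card (insert m L) = card A"
      using u(3) cardS[OF S(1)] L mL fin unfolding inv_def by simp
    have df: "deficiency (assigns A (insert m L)) = 1" using u(4) L unfolding inv_def by simp
    have "\<forall>m'\<in>insert m L. lit_var m' \<in> cs_vars G \<and> lit_var m' \<noteq> lit_var l \<and> var_degree G (lit_var m') = 4"
      using L mG m(2) unfolding inv_def by blast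
    then show "inv (insert m L)"
      using u(1) cons vs dg cd df L unfolding inv_def by blast
  qed
  have "\<exists>L. inv L \<and> (\<forall>L'. inv L' \<longrightarrow> card L' \<le> card L)"
  proof (rule ex_has_greatest_nat[where b = "Suc (card A)"])
    show "inv {a}" by (rule inv0)
    show "\<forall>L. inv L \<longrightarrow> card L < Suc (card A)" by (auto simp: inv_def)
  qed
  then obtain L where L: "inv L" and max: "\<And>L'. inv L' \<Longrightarrow> card L' \<le> card L" by blast
  define S where "S = assigns A L"
  have S: "S \<in> MU" "deficiency S = 1" "cs_vars S = cs_vars A - lit_var ` L" "card S + card L = card A"
    "\<And>z. z \<in> cs_vars S \<Longrightarrow> var_degree S z = var_degree A z" "finite L" "a \<in> L"
    "\<And>m. m \<in> L \<Longrightarrow> complement m \<notin> L"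
    "\<And>m. m \<in> L \<Longrightarrow> lit_var m \<in> cs_vars G \<and> lit_var m \<noteq> lit_var l \<and> var_degree G (lit_var m) = 4"
    using L unfolding inv_def S_def by auto
  have "cs_vars S = {}"
  proof (rule ccontr)
    assume ne: "cs_vars S \<noteq> {}"
    have no_empty: "{} \<notin> S"
      using MU_empty_clause[OF S(1)] ne by (auto simp: cs_vars_def clause_vars_def)
    obtain x where x: "x \<in> cs_vars S" "var_degree S x = 2" using MU1_degree_two[OF S(1,2) ne] by blast
    then have "x = lit_var b" using S(3,5) b(3) by auto
    then have bL: "lit_var b \<notin> lit_var ` L" using x S(3) by auto
    have next_lit: "\<exists>m'\<in>L. {complement m, m'} \<in> A" if m: "m \<in> L" for m
    proof -
      obtain m' where m': "{complement m, m'} \<in> G" "lit_var m' \<in> cs_vars G" "lit_var m' \<noteq> lit_var m"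
        "var_degree G (lit_var m') = 4"
        using binary_clause[of m] S(9)[OF m] by blast
      let ?E = "{complement m, m'}"
      have vE: "clause_vars ?E = {lit_var m, lit_var m'}" by (simp add: clause_vars_def)
      have mm: "m \<noteq> l" "m \<noteq> complement l" using S(9)[OF m] by auto
      have falsified: False if "m'' \<in> L" "E \<in> A" "E \<subseteq> {complement m'', complement k}" "k \<in> L" for m'' k E
      proof -
        have "E \<inter> L = {}" "E - complement ` L = {}" using that S(8) by blast+
        then have "{} \<in> S" unfolding S_def assigns_def using that(2) by (metis (mono_tags, lifting) imageI mem_Collect_eq)
        then show False using no_empty by blast
      qed
      \<comment> \<open>Otherwise the clause passes through \<open>l\<close> and contains the
        variable of \<open>b\<close>, which is not one of \<open>L\<close>.\<close>
      have "m' \<noteq> l"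
      proof
        assume "m' = l"
        then have "lit_var b \<in> clause_vars ?E" using b(2) m'(1) by blast
        then show False using vE b(1) bL m \<open>m' = l\<close> by auto
      qed
      \<comment> \<open>Otherwise the clause contains the variable of \<open>a\<close>, so
        \<open>m = a\<close>, and \<open>A\<close> contains both \<open>{a}\<close> and
        \<open>{complement a}\<close>.\<close>
      moreover have "m' \<noteq> complement l"
      proof
        assume e: "m' = complement l"
        then have "lit_var a \<in> clause_vars ?E" using a(5) m'(1) by blast
        then have "lit_var a = lit_var m" using vE a(3) e by auto
        then have "m = a" using S(7,8) m unfolding lit_var_eq_iff by auto
        have "?E - {complement l} = {complement a}" using \<open>m = a\<close> e mm by auto
        moreover have "l \<notin> ?E" using e mm by auto
        ultimately have "{complement a} \<in> A" unfolding A_def assign_def using m'(1) by (metis (mono_tags, lifting) imageI mem_Collect_eq)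
        then show False using falsified[of a "{complement a}" a] S(7) by simp
      qed
      moreover have "complement m \<noteq> l" "complement m \<noteq> complement l" using mm by auto
      ultimately have "l \<notin> ?E" "?E - {complement l} = ?E" by auto
      then have EA: "?E \<in> A" unfolding A_def assign_def using m'(1) by (metis (mono_tags, lifting) imageI mem_Collect_eq)
      have "complement m' \<notin> L"
        using falsified[of m ?E "complement m'"] m EA by auto
      \<comment> \<open>Otherwise \<open>{m'}\<close> is a unit clause after \<open>L\<close>,
        against maximality.\<close>
      moreover have "m' \<in> L"
      proof (rule ccontr)
        assume "m' \<notin> L"
        have "m' \<notin> complement ` L" using \<open>complement m' \<notin> L\<close> by auto
        then have "?E \<inter> L = {}" "?E - complement ` L = {m'}" using \<open>m' \<notin> L\<close> S(8)[OF m] m by auto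
        then have "{m'} \<in> assigns A L" unfolding assigns_def using EA by (metis (mono_tags, lifting) imageI mem_Collect_eq)
        from step[OF L this m'(4)] max show False by fastforce
      qed
      ultimately show ?thesis using EA by blast
    qed
    then obtain f where f: "\<And>m. m \<in> L \<Longrightarrow> f m \<in> L \<and> {complement m, f m} \<in> A" by metis
    let ?h = "\<lambda>m. {complement m, f m}"
    let ?T = "{C \<in> A. C \<inter> L \<noteq> {}}"
    have finA: "finite A" using MU_finite p(1) by blast
    have inj: "inj_on ?h L"
    proof (rule inj_onI)
      fix m k assume mk: "m \<in> L" "k \<in> L" "?h m = ?h k"
      then have "complement m = complement k \<or> complement m = f k" by blast
      then show "m = k" using S(8)[OF mk(1)] f[OF mk(2)] by auto
    qed
    have "{a} \<notin> ?h ` L"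
    proof
      assume "{a} \<in> ?h ` L"
      then obtain m where "m \<in> L" "complement m \<in> {a}" by blast
      then show False using S(7,8) by auto
    qed
    then have "card (insert {a} (?h ` L)) = Suc (card L)" using card_image[OF inj] S(6) by simp
    moreover have "insert {a} (?h ` L) \<subseteq> ?T" using f aA S(7) by auto
    moreover have "finite ?T" using finA by simp
    ultimately have "Suc (card L) \<le> card ?T" using card_mono[of ?T "insert {a} (?h ` L)"] by linarith
    moreover have "card S \<le> card {C \<in> A. C \<inter> L = {}}"
      unfolding S_def assigns_def using finA by (intro card_image_le) simp
    moreover have "A = ?T \<union> {C \<in> A. C \<inter> L = {}}" "?T \<inter> {C \<in> A. C \<inter> L = {}} = {}" by auto
    then have "card A = card ?T + card {C \<in> A. C \<inter> L = {}}"
      using finA by (metis (no_types, lifting) card_Un_disjoint finite_Un)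
    ultimately show False using S(4) by simp
  qed
  then have "cs_vars A \<subseteq> lit_var ` L" using S(3) by blast
  show ?thesis
  proof (cases "v = lit_var l")
    case True then show ?thesis using l by simp
  next
    case False
    then have "v \<in> cs_vars A" using v p(2) by blast
    then show ?thesis using \<open>cs_vars A \<subseteq> lit_var ` L\<close> S(9) by auto
  qed
qed

end

text \<open>In a saturated extension each literal occurs twice, so at most twice here, while the sum
  is at least 4. Unit clauses matter: take \<open>{x}\<close> and the four full clauses on two
  further variables, each enlarged by \<open>complement x\<close>; then \<open>x\<close> occurs
  once.\<close>

lemma MU2_literal_degree:
  assumes F: "F \<in> MU" "deficiency F = 2" "\<And>v. v \<in> cs_vars F \<Longrightarrow> 4 \<le> var_degree F v" "\<And>l. {l} \<notin> F"
    and l: "lit_var l \<in> cs_vars F"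
  shows "ld F l = 2"
proof -
  obtain F' where F': "saturated F'" "extends F F'" using saturation_exists F(1) by blast
  have M: "F' \<in> MU" using F' saturated_MU by blast
  have vs: "cs_vars F' = cs_vars F" using F' extends_cs_vars by blast
  have le: "ld F m \<le> ld F' m" for m using extends_ld_le[OF F'(2) MU_finite[OF M]] .
  interpret saturated_def2 F'
  proof
    show "saturated F'" by (rule F')
    show "deficiency F' = 2" using extends_deficiency[OF F'(2)] F(2) by simp
    show "4 \<le> var_degree F' v" if "v \<in> cs_vars F'" for v
      using F(3)[of v] that vs extends_var_degree_le[OF F'(2) MU_finite[OF M], of v] by simp
    show "{m} \<notin> F'" for m
    proof
      assume "{m} \<in> F'"
      then obtain C where C: "C \<in> F" "C \<subseteq> {m}" by (rule extends_supersetE[OF F'(2)])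
      then have "C = {}" using F(4) by (metis subset_singletonD)
      then have "F = {{}}" using MU_empty_clause F(1) C by blast
      then show False using l by (auto simp: cs_vars_def clause_vars_def)
    qed
  qed
  have "ld F' m = 2" if "lit_var m = lit_var l" for m
    using ld_two[of m] all_degree_four[of "lit_var l"] l vs that by simp
  then have "ld F' l = 2" "ld F' (complement l) = 2" by simp_all
  moreover have "4 \<le> ld F l + ld F (complement l)"
    using F(3)[OF l] var_degree_eq_ld[OF MU_clause_set[OF F(1)]] by metis
  ultimately show ?thesis using le[of l] le[of "complement l"] by simp
qed


section \<open>Deficiency six\<close>

text \<open>On \<open>cs_vars F\<close> the assignment \<open>\<lambda>v. Neg v \<in> Q\<close>
  falsifies only literals of \<open>Q\<close>, and some clause is falsified.\<close>

lemma unsat_subclause: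
  assumes F: "\<forall>\<phi>. \<not> models \<phi> F" and Q: "\<And>v. v \<in> cs_vars F \<Longrightarrow> Pos v \<in> Q \<or> Neg v \<in> Q"
  shows "\<exists>D\<in>F. D \<subseteq> Q"
proof -
  obtain D where D: "D \<in> F" "\<forall>x\<in>D. \<not> lit_true (\<lambda>v. Neg v \<in> Q) x"
    using F unfolding models_def by metis
  have "x \<in> Q" if x: "x \<in> D" for x
    using D(2)[rule_format, OF x] Q[OF in_cs_vars[OF D(1) x]] by (cases x) auto
  then show ?thesis using D(1) by blast
qed

locale saturated_def6 =
  fixes F :: "'v literal set set"
  assumes sat: "saturated F" and def6: "deficiency F = 6"
    and deg9: "\<And>v. v \<in> cs_vars F \<Longrightarrow> 9 \<le> var_degree F v"
    and no_unit: "\<And>l. {l} \<notin> F"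
begin

lemma in_MU: "F \<in> MU"
  using sat by (rule saturated_MU)

lemma vars_ne: "cs_vars F \<noteq> {}"
proof
  assume "cs_vars F = {}"
  then have "F = {{}}" using MU_no_vars in_MU by blast
  then show False using def6 by (simp add: deficiency_empty_clause)
qed

text \<open>The deficiency allows at most six occurrences of a literal. Setting a literal with six
  would leave deficiency 1 and degrees at least 3, against the degree bound.\<close>

lemma ld_cases:
  assumes l: "lit_var l \<in> cs_vars F" "var_degree F (lit_var l) = 9"
  shows "ld F l = 5 \<and> ld F (complement l) = 4 \<or> ld F l = 4 \<and> ld F (complement l) = 5"
proof -
  have sum: "ld F l + ld F (complement l) = 9" using var_degree_eq_ld[OF MU_clause_set[OF in_MU], of l] l by simp
  have le5: "ld F m \<le> 5" if m: "lit_var m = lit_var l" for m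
  proof (rule ccontr)
    assume n5: "\<not> ?thesis"
    have mv: "lit_var m \<in> cs_vars F" using m l by simp
    have min: "var_degree F (lit_var m) \<le> var_degree F w" if "w \<in> cs_vars F" for w
      using deg9[OF that] m l by simp
    note s = split_min_degree[OF sat mv min]
    have "int (ld F m) \<le> 6" using ld_le_deficiency[OF sat mv min] def6 by simp
    then have m6: "ld F m = 6" using n5 by simp
    then have cm: "ld F (complement m) = 3" using s(4) m l by simp
    have "3 \<le> var_degree (assign F m) w" if "w \<in> cs_vars (assign F m)" for w
    proof -
      have w: "w \<in> cs_vars F" "w \<noteq> lit_var m" using that s(2) by auto
      then show ?thesis using var_degree_assign_ge[OF in_MU w(2)] deg9[OF w(1)] m6 by simp
    qed
    then have "int 3 \<le> deficiency (assign F m) + int 1"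
      using cm by (intro MU_degree_bound[OF s(1) assign_cs_vars_ne[OF in_MU s(1)]]) auto
    then show False using s(3) m6 def6 by simp
  qed
  show ?thesis using sum le5[of l] le5[of "complement l"] by simp linarith
qed

text \<open>
  Setting \<open>l\<close> to true leaves deficiency 3 and degrees at least 5; a variable whose degree there is only 5
  occurs in all four clauses containing \<open>l\<close>, and there are at least two such variables.
\<close>

lemma large_clauses:
  assumes l: "lit_var l \<in> cs_vars F" "var_degree F (lit_var l) = 9" "ld F l = 4"
    and C: "C \<in> F" "l \<in> C"
  shows "C - {l} \<noteq> {m}"
proof -
  have min: "var_degree F (lit_var l) \<le> var_degree F w" if "w \<in> cs_vars F" for w
    using deg9[OF that] l by simp
  note s = split_min_degree[OF sat l(1) min]
  obtain H where H: "saturated H" "extends (assign F l) H" using saturation_exists s(1) by blast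
  have MH: "H \<in> MU" using H saturated_MU by blast
  have vs: "cs_vars H = cs_vars F - {lit_var l}" using extends_cs_vars[OF H(2)] s(2) by simp
  have dH: "deficiency H = 3" using extends_deficiency[OF H(2)] s(3) l(3) def6 by simp
  have le: "var_degree (assign F l) w \<le> var_degree H w" for w
    using extends_var_degree_le[OF H(2) MU_finite[OF MH]] .
  have deg5: "5 \<le> var_degree H w" if "w \<in> cs_vars H" for w
  proof -
    have w: "w \<in> cs_vars F" "w \<noteq> lit_var l" using that vs by auto
    then show ?thesis using var_degree_assign_ge[OF in_MU w(2)] deg9[OF w(1)] l(3) le[of w] by simp
  qed
  have "cs_vars H \<noteq> {}"
    using assign_cs_vars_ne[OF in_MU s(1)] ld_cases[OF l(1,2)] l(3) extends_cs_vars[OF H(2)] by simp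
  then obtain u where u: "lit_var u \<in> cs_vars H"
    "\<And>w. w \<in> cs_vars H \<Longrightarrow> var_degree H (lit_var u) \<le> var_degree H w" "ld H (complement u) \<le> ld H u"
    using saturated_min_literal[OF H(1)] by blast
  note t = split_min_degree[OF H(1) u(1,2)]
  have u5: "var_degree H (lit_var u) = 5"
  proof (rule ccontr)
    assume "var_degree H (lit_var u) \<noteq> 5"
    then have "6 \<le> var_degree H w" if "w \<in> cs_vars H" for w
      using deg5[OF u(1)] u(2)[OF that] by simp
    \<comment> \<open>Minimum degree 6 has \<open>q = 2\<close> and would need deficiency 4.\<close>
    then have "int 6 \<le> deficiency H + int 2"
      using u(1) by (intro MU_degree_bound[OF MH]) auto
    then show False using dH by simp
  qed
  have u3: "ld H u = 3" "ld H (complement u) = 2"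
    using ld_le_deficiency[OF H(1) u(1,2)] dH t(4) u5 u(3) by auto
  \<comment> \<open>Deficiency 1 yields a variable \<open>y\<close> of degree two. Only three
    clauses were satisfied, so \<open>y\<close> has degree at most 5 in \<open>H\<close> and is the
    second variable sought.\<close>
  have "deficiency (assign H u) = 1" using t(3) dH u3 by simp
  moreover have "cs_vars (assign H u) \<noteq> {}" using assign_cs_vars_ne[OF MH t(1)] u3 by simp
  ultimately obtain y where y: "y \<in> cs_vars (assign H u)" "var_degree (assign H u) y = 2"
    using MU1_degree_two[OF t(1)] by blast
  then have yH: "y \<in> cs_vars H" "y \<noteq> lit_var u" using t(2) by auto
  then have y5: "var_degree H y \<le> 5" using var_degree_assign_ge[OF MH yH(2)] y(2) u3 by simp
  have occ: "z \<in> clause_vars C" if z: "z \<in> cs_vars H" "var_degree H z \<le> 5" for z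
  proof -
    have zF: "z \<in> cs_vars F" "z \<noteq> lit_var l" using z vs by auto
    have "4 \<le> card {C \<in> F. l \<in> C \<and> z \<in> clause_vars C}"
      using var_degree_assign[OF in_MU zF(2)] deg9[OF zF(1)] le[of z] z(2) by simp
    moreover have fin: "finite {C \<in> F. l \<in> C}" using MU_finite[OF in_MU] by simp
    moreover have sub: "{C \<in> F. l \<in> C \<and> z \<in> clause_vars C} \<subseteq> {C \<in> F. l \<in> C}" by blast
    ultimately have "{C \<in> F. l \<in> C \<and> z \<in> clause_vars C} = {C \<in> F. l \<in> C}"
      using l(3) card_seteq[OF fin sub] by (simp add: ld_def)
    then show ?thesis using C by blast
  qed
  show ?thesis
  proof
    assume "C - {l} = {m}"
    then have "C = {l, m}" using C(2) by blast
    then have "clause_vars C \<subseteq> {lit_var l, lit_var m}" by (simp add: clause_vars_def)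
    moreover have "lit_var u \<in> clause_vars C" "y \<in> clause_vars C"
      using occ u(1) u5 yH(1) y5 by auto
    moreover have "lit_var u \<noteq> lit_var l" "y \<noteq> lit_var l" using u(1) yH(1) vs by auto
    ultimately have "lit_var u = lit_var m" "y = lit_var m" by auto
    then show False using yH(2) by simp
  qed
qed

text \<open>A unit clause after setting \<open>l\<close> would stem from a binary clause through
  \<open>complement l\<close>, which occurs four times; \<open>large_clauses\<close> forbids that.
  So all other degrees become exactly 4, and falling from at least 9 uses up all five clauses
  through \<open>l\<close>.\<close>

lemma five_literal:
  assumes l: "lit_var l \<in> cs_vars F" "var_degree F (lit_var l) = 9" "ld F l = 5"
    and m: "lit_var m \<in> cs_vars F" "lit_var m \<noteq> lit_var l"
  shows "ld (assign F l) m = 2"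
    and "var_degree F (lit_var m) = 9"
    and "\<And>C. C \<in> F \<Longrightarrow> l \<in> C \<Longrightarrow> lit_var m \<in> clause_vars C"
proof -
  have min: "var_degree F (lit_var l) \<le> var_degree F w" if "w \<in> cs_vars F" for w
    using deg9[OF that] l by simp
  note s = split_min_degree[OF sat l(1) min]
  have def2: "deficiency (assign F l) = 2" using s(3) l def6 by simp
  have deg4: "4 \<le> var_degree (assign F l) w" if "w \<in> cs_vars (assign F l)" for w
  proof -
    have w: "w \<in> cs_vars F" "w \<noteq> lit_var l" using that s(2) by auto
    then show ?thesis using var_degree_assign_ge[OF in_MU w(2)] deg9[OF w(1)] l(3) by simp
  qed
  have nu: "{x} \<notin> assign F l" for x
  proof
    assume "{x} \<in> assign F l"
    then obtain C where C: "C \<in> F" "l \<notin> C" "C - {complement l} = {x}" by (auto simp: assign_def)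
    then have "complement l \<in> C" using no_unit by (metis Diff_empty Diff_insert0)
    then show False
      using large_clauses[of "complement l" C x] C l ld_cases[OF l(1,2)] by simp
  qed
  have two: "ld (assign F l) x = 2" if "lit_var x = lit_var m" for x
    using that m s(2) by (intro MU2_literal_degree[OF s(1) def2 deg4 nu]) auto
  then show "ld (assign F l) m = 2" by simp
  have d4: "var_degree (assign F l) (lit_var m) = 4"
    using var_degree_eq_ld[OF MU_clause_set[OF s(1)], of m] two[of m] two[of "complement m"] by simp
  have fin: "finite {C \<in> F. l \<in> C}" using MU_finite[OF in_MU] by simp
  have sub: "{C \<in> F. l \<in> C \<and> lit_var m \<in> clause_vars C} \<subseteq> {C \<in> F. l \<in> C}" by blast
  have le: "card {C \<in> F. l \<in> C \<and> lit_var m \<in> clause_vars C} \<le> 5"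
    using card_mono[OF fin sub] l(3) by (simp add: ld_def)
  then show "var_degree F (lit_var m) = 9"
    using var_degree_assign[OF in_MU m(2)] d4 deg9[OF m(1)] by simp
  then have "card {C \<in> F. l \<in> C \<and> lit_var m \<in> clause_vars C} = 5"
    using var_degree_assign[OF in_MU m(2)] d4 by simp
  then have "{C \<in> F. l \<in> C \<and> lit_var m \<in> clause_vars C} = {C \<in> F. l \<in> C}"
    using l(3) card_subset_eq[OF fin sub] by (simp add: ld_def)
  then show "lit_var m \<in> clause_vars C" if "C \<in> F" "l \<in> C" for C using that by blast
qed

lemma all_degree_nine:
  assumes "v \<in> cs_vars F"
  shows "var_degree F v = 9"
proof -
  have "\<exists>w\<in>cs_vars F. var_degree F w = 9"
  proof (rule ccontr)
    assume "\<not> ?thesis"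
    then have "10 \<le> var_degree F w" if "w \<in> cs_vars F" for w using deg9[OF that] that by fastforce
    \<comment> \<open>Minimum degree 10 has \<open>q = 3\<close> and would need deficiency
      7.\<close>
    then have "int 10 \<le> deficiency F + int 3"
      using vars_ne by (intro MU_degree_bound[OF in_MU]) auto
    then show False using def6 by simp
  qed
  then obtain w where w: "w \<in> cs_vars F" "var_degree F w = 9" by blast
  obtain l where l: "lit_var l = w" "ld F l = 5"
    using ld_cases[of "Pos w"] w by (metis complement.simps(1) lit_var.simps)
  show ?thesis
  proof (cases "v = w")
    case False
    then show ?thesis using five_literal(2)[of l "Pos v"] l w assms by simp
  qed (use w in simp)
qed

section \<open>Full clauses coded by sets of flipped literals\<close>

definition five_lits where "five_lits = {l. lit_var l \<in> cs_vars F \<and> ld F l = 5}"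

lemma five_lits_iff: "lit_var m \<in> cs_vars F \<Longrightarrow> complement m \<in> five_lits \<longleftrightarrow> m \<notin> five_lits"
  using ld_cases[of m] all_degree_nine by (auto simp: five_lits_def)

lemma five_lits_var: "l \<in> five_lits \<Longrightarrow> lit_var l \<in> cs_vars F"
  by (simp add: five_lits_def)

lemma five_lits_clause_full:
  assumes "l \<in> five_lits" "C \<in> F" "l \<in> C"
  shows "clause_vars C = cs_vars F"
proof
  show "clause_vars C \<subseteq> cs_vars F" using assms by (auto simp: cs_vars_def)
  show "cs_vars F \<subseteq> clause_vars C"
  proof
    fix v assume v: "v \<in> cs_vars F"
    show "v \<in> clause_vars C"
    proof (cases "v = lit_var l")
      case True then show ?thesis using assms by (auto simp: clause_vars_def)
    next
      case False
      then show ?thesis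
        using five_literal(3)[of l "Pos v" C] assms v all_degree_nine[OF five_lits_var[OF assms(1)]] by (simp add: five_lits_def)
    qed
  qed
qed

text \<open>Two of the five occurrences of \<open>m\<close> survive setting \<open>l\<close>, so
  three lie with \<open>l\<close>. The clauses of those two are full, hence contain
  \<open>complement l\<close>.\<close>

lemma five_lits_pair:
  assumes "l \<in> five_lits" "m \<in> five_lits" "l \<noteq> m"
  shows "card {C \<in> F. l \<in> C \<and> m \<in> C} = 3" "\<exists>C\<in>F. m \<in> C \<and> complement l \<in> C"
proof -
  have ne: "lit_var m \<noteq> lit_var l"
    using assms five_lits_iff[OF five_lits_var[OF assms(1)]] unfolding lit_var_eq_iff by auto
  have two: "ld (assign F l) m = 2"
    using five_literal(1)[of l m] assms all_degree_nine ne by (simp add: five_lits_def)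
  show c: "card {C \<in> F. l \<in> C \<and> m \<in> C} = 3"
    using ld_assign[OF in_MU ne] two assms by (simp add: five_lits_def)
  have "card {C \<in> F. m \<in> C} = 5" using assms(2) by (simp add: five_lits_def ld_def)
  then have "{C \<in> F. m \<in> C} \<noteq> {C \<in> F. l \<in> C \<and> m \<in> C}"
    using c by (intro notI) simp
  then obtain C where C: "C \<in> F" "m \<in> C" "l \<notin> C" by blast
  then have "lit_var l \<in> clause_vars C" using five_lits_clause_full[OF assms(2)] five_lits_var[OF assms(1)] by simp
  then have "complement l \<in> C" using C(3) by (simp add: in_clause_vars_iff)
  then show "\<exists>C\<in>F. m \<in> C \<and> complement l \<in> C" using C by blast
qed

text \<open>\<open>five_lits\<close> has one literal per variable, so a full clause is determined by
  the set \<open>N\<close> of those whose sign it reverses.\<close>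

definition flip where "flip N = (five_lits - N) \<union> complement ` N"

lemma flip_covers: "N \<subseteq> five_lits \<Longrightarrow> v \<in> cs_vars F \<Longrightarrow> Pos v \<in> flip N \<or> Neg v \<in> flip N"
proof -
  assume "N \<subseteq> five_lits" "v \<in> cs_vars F"
  then have "Pos v \<in> five_lits \<or> Neg v \<in> five_lits" using five_lits_iff[of "Pos v"] by auto
  moreover have "Pos v \<in> N \<Longrightarrow> Neg v \<in> complement ` N" "Neg v \<in> N \<Longrightarrow> Pos v \<in> complement ` N"
    by (force simp: image_iff)+
  ultimately show ?thesis unfolding flip_def by blast
qed

lemma flip_consistent:
  assumes "N \<subseteq> five_lits" "x \<in> flip N"
  shows "complement x \<notin> flip N"
proof -
  have a: "complement x \<notin> five_lits" if "x \<in> five_lits" for x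
    using five_lits_iff[OF five_lits_var[OF that]] that by simp
  have "x \<in> five_lits - N \<or> complement x \<in> N"
    using assms(2) by (auto simp: flip_def)
  then show ?thesis
  proof
    assume "x \<in> five_lits - N"
    then show ?thesis using a[of x] by (auto simp: flip_def)
  next
    assume "complement x \<in> N"
    then have "x \<notin> five_lits" using a[of "complement x"] assms(1) by auto
    then show ?thesis using \<open>complement x \<in> N\<close> assms(1) by (auto simp: flip_def)
  qed
qed

lemma full_subset_flip:
  assumes "N \<subseteq> five_lits" "D \<subseteq> flip N" "clause_vars D = cs_vars F"
  shows "D = flip N"
proof
  show "flip N \<subseteq> D"
  proof
    fix x assume x: "x \<in> flip N"
    have "lit_var x \<in> cs_vars F" using x assms(1) five_lits_var by (auto simp: flip_def)
    then have "x \<in> D \<or> complement x \<in> D" using assms(3) in_clause_vars_iff by metis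
    then show "x \<in> D" using flip_consistent[OF assms(1) x] assms(2) by blast
  qed
qed (rule assms)

text \<open>Unsatisfiability puts a clause inside \<open>flip N\<close>. If it meets
  \<open>five_lits\<close> it is full and equals \<open>flip N\<close>; otherwise it has only
  flipped literals.\<close>

lemma flip_cases:
  assumes "N \<subseteq> five_lits"
  shows "flip N \<in> F \<or> (\<exists>D\<in>F. D \<subseteq> complement ` N)"
proof -
  obtain D where D: "D \<in> F" "D \<subseteq> flip N"
    using unsat_subclause[of F "flip N"] MU_unsat[OF in_MU] flip_covers[OF assms] by blast
  show ?thesis
  proof (cases "D \<inter> five_lits = {}")
    case True
    then have "D \<subseteq> complement ` N" using D(2) by (auto simp: flip_def)
    then show ?thesis using D by blast
  next
    case False
    then have "clause_vars D = cs_vars F" using five_lits_clause_full D by blast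
    then show ?thesis using full_subset_flip[OF assms D(2)] D(1) by simp
  qed
qed

lemma finite_five_lits: "finite five_lits"
proof -
  have "five_lits \<subseteq> \<Union>F"
    using MU_literal_occurs[OF in_MU] five_lits_var by blast
  then show ?thesis
    using finite_subset[of five_lits "\<Union>F"] MU_clause_set[OF in_MU] by (auto simp: is_clause_set_def is_clause_def)
qed

lemma full_eq_flip:
  assumes C: "C \<in> F" "clause_vars C = cs_vars F"
  shows "C = flip (five_lits - C)"
proof (rule full_subset_flip)
  show "C \<subseteq> flip (five_lits - C)"
  proof
    fix x assume x: "x \<in> C"
    show "x \<in> flip (five_lits - C)"
    proof (cases "x \<in> five_lits")
      case True then show ?thesis using x by (auto simp: flip_def)
    next
      case False
      then have "complement x \<in> five_lits" using five_lits_iff in_cs_vars[OF C(1) x] by blast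
      moreover have "complement x \<notin> C" using clause_setD(3)[OF MU_clause_set[OF in_MU] C(1) x] .
      ultimately show ?thesis unfolding flip_def image_def by (metis (mono_tags, lifting) DiffI UnCI complement_complement mem_Collect_eq)
    qed
  qed
qed (use C in auto)

text \<open>The five clauses through \<open>l\<close> are full, hence given by different subsets of
  \<open>five_lits - {l}\<close>, and \<open>5 \<le> 2 ^ p\<close> needs
  \<open>p \<ge> 3\<close>.\<close>

lemma card_five_lits: "4 \<le> card five_lits"
proof -
  obtain l where l: "l \<in> five_lits"
    using vars_ne five_lits_iff by (metis equals0I lit_var.simps(1) lit_var_complement)
  let ?X = "{C \<in> F. l \<in> C}"
  have "inj_on (\<lambda>C. five_lits - C) ?X"
  proof (rule inj_onI)
    fix C D assume "C \<in> ?X" "D \<in> ?X" and e: "five_lits - C = five_lits - D"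
    then have "C = flip (five_lits - C)" "D = flip (five_lits - D)"
      using full_eq_flip five_lits_clause_full[OF l] by blast+
    then show "C = D" using e by simp
  qed
  moreover have "(\<lambda>C. five_lits - C) ` ?X \<subseteq> Pow (five_lits - {l})" by blast
  ultimately have "card ?X \<le> card (Pow (five_lits - {l}))"
    using finite_five_lits by (intro card_inj_on_le) auto
  then have "5 \<le> (2::nat) ^ card (five_lits - {l})"
    using l finite_five_lits by (simp add: card_Pow five_lits_def ld_def)
  then have "\<not> card (five_lits - {l}) \<le> 2"
    using power_increasing[of "card (five_lits - {l})" 2 "2::nat"] by auto
  then show ?thesis using l finite_five_lits by simp
qed

text \<open>\<open>flip N\<close> is forced into \<open>F\<close> for several small
  \<open>N\<close>, but two literals of \<open>five_lits\<close> share only three clauses.\<close>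

lemma contradiction: False
proof -
  have two: "\<exists>m\<in>five_lits. m \<notin> S" if "finite S" "card S < 4" for S
    using card_five_lits that finite_five_lits by (metis card_mono le_trans not_le subsetI)
  have five_lits_flip: "five_lits = flip {}" by (simp add: flip_def)
  have PF: "five_lits \<in> F"
  proof -
    have "\<not> (\<exists>D\<in>F. D \<subseteq> {})"
      using MU_empty_clause[OF in_MU] vars_ne by (auto simp: cs_vars_def clause_vars_def)
    then show ?thesis using flip_cases[of "{}"] five_lits_flip by auto
  qed
  have flip1: "flip {u} \<in> F" if u: "u \<in> five_lits" for u
  proof -
    obtain m where m: "m \<in> five_lits" "m \<noteq> u" using two[of "{u}"] by auto
    \<comment> \<open>A clause inside \<open>{complement u}\<close> would be a proper subset of this
      one.\<close>
    obtain C where C: "C \<in> F" "m \<in> C" "complement u \<in> C" using five_lits_pair(2)[of u m] u m by blast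
    have "\<not> (\<exists>D\<in>F. D \<subseteq> complement ` {u})"
    proof
      assume "\<exists>D\<in>F. D \<subseteq> complement ` {u}"
      then obtain D where D: "D \<in> F" "D \<subseteq> {complement u}" by auto
      then have "D = C" using MU_antichain[OF in_MU D(1) C(1)] C by blast
      then have "m = complement u" using D(2) C(2) by blast
      then show False using five_lits_iff[OF five_lits_var[OF u]] u m by simp
    qed
    then show ?thesis using flip_cases[of "{u}"] u by auto
  qed
  have flip_inj: "N = N'" if "N \<subseteq> five_lits" "N' \<subseteq> five_lits" "flip N = flip N'" for N N'
  proof -
    have "complement x \<notin> five_lits" if "x \<in> five_lits" for x using five_lits_iff[OF five_lits_var[OF that]] that by simp
    then have "five_lits - flip K = K" if "K \<subseteq> five_lits" for K
      using that unfolding flip_def by blast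
    then show ?thesis using that by metis
  qed
  have flip_memb: "x \<in> flip N" if "x \<in> five_lits" "x \<notin> N" for x N using that by (simp add: flip_def)
  obtain l where l: "l \<in> five_lits" using two[of "{}"] by auto
  obtain m where m: "m \<in> five_lits" "m \<noteq> l" using two[of "{l}"] by auto
  have fin: "finite {C \<in> F. Q C}" for Q using MU_finite[OF in_MU] by simp
  have card_le: "card \<N> \<le> 3"
    if "x \<in> five_lits" "y \<in> five_lits" "x \<noteq> y" "\<And>N. N \<in> \<N> \<Longrightarrow> N \<subseteq> five_lits - {x, y} \<and> flip N \<in> F" for x y \<N>
  proof -
    have "inj_on flip \<N>" using flip_inj that(4) by (meson inj_onI subset_trans Diff_subset)
    moreover have "flip ` \<N> \<subseteq> {C \<in> F. x \<in> C \<and> y \<in> C}" using that flip_memb by blast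
    ultimately have "card \<N> \<le> card {C \<in> F. x \<in> C \<and> y \<in> C}" using fin by (rule card_inj_on_le)
    then show ?thesis using five_lits_pair(1) that by simp
  qed
  \<comment> \<open>\<open>l\<close> and \<open>m\<close> both lie in \<open>flip {}\<close> and in
    \<open>flip {u}\<close> for all other \<open>u\<close>, which are
    \<open>card five_lits - 1\<close> clauses.\<close>
  have "card five_lits \<le> 4"
  proof -
    let ?N = "insert {} ((\<lambda>u. {u}) ` (five_lits - {l, m}))"
    have "card ?N = Suc (card (five_lits - {l, m}))"
      using finite_five_lits by (subst card_insert_disjoint) (auto simp: card_image)
    moreover have "card (five_lits - {l, m}) = card five_lits - 2"
      using l m finite_five_lits by (subst card_Diff_subset) auto
    moreover have "card ?N \<le> 3"
      using l m PF five_lits_flip flip1 by (intro card_le[of l m]) auto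
    ultimately show ?thesis by simp
  qed
  moreover have "card {C \<in> F. l \<in> C} = 5" using l by (simp add: five_lits_def ld_def)
  moreover have "card (insert five_lits ((\<lambda>u. flip {u}) ` (five_lits - {l}))) \<le> card five_lits"
  proof -
    have "card (insert five_lits ((\<lambda>u. flip {u}) ` (five_lits - {l}))) \<le> Suc (card ((\<lambda>u. flip {u}) ` (five_lits - {l})))"
      using finite_five_lits by (simp add: card_insert_if)
    also have "\<dots> \<le> Suc (card (five_lits - {l}))"
      using finite_five_lits card_image_le[of "five_lits - {l}" "\<lambda>u. flip {u}"] by simp
    also have "\<dots> = card five_lits" using finite_five_lits l by (rule card_Suc_Diff1)
    finally show ?thesis .
  qed
  \<comment> \<open>Five clauses contain \<open>l\<close>, but at most four of them flip fewer than
    two literals.\<close>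
  ultimately have "\<not> {C \<in> F. l \<in> C} \<subseteq> insert five_lits ((\<lambda>u. flip {u}) ` (five_lits - {l}))"
    using card_mono[of "insert five_lits ((\<lambda>u. flip {u}) ` (five_lits - {l}))" "{C \<in> F. l \<in> C}"] finite_five_lits by auto
  then obtain C where C: "C \<in> F" "l \<in> C" "C \<noteq> five_lits" "\<And>u. u \<in> five_lits \<Longrightarrow> u \<noteq> l \<Longrightarrow> C \<noteq> flip {u}" by blast
  have Cf: "C = flip (five_lits - C)" using full_eq_flip[OF C(1) five_lits_clause_full[OF l C(1,2)]] .
  then have "five_lits - C \<noteq> {}" using C(3) five_lits_flip by metis
  then obtain a where a: "a \<in> five_lits" "a \<notin> C" by blast
  then have al: "a \<noteq> l" using C by blast
  have "five_lits - C \<noteq> {a}" using C(4)[OF a(1) al] Cf by metis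
  then obtain b where b: "b \<in> five_lits" "b \<notin> C" "b \<noteq> a" using a by blast
  then have bl: "b \<noteq> l" using C by blast
  have comp: "complement a \<in> C" "complement b \<in> C"
    using Cf a b unfolding flip_def by blast+
  \<comment> \<open>Such a clause would be a subset of \<open>C\<close> and hence equal to it,
    although \<open>C\<close> contains \<open>l\<close>.\<close>
  have "\<not> (\<exists>D\<in>F. D \<subseteq> complement ` {a, b})"
  proof
    assume "\<exists>D\<in>F. D \<subseteq> complement ` {a, b}"
    then obtain D where D: "D \<in> F" "D \<subseteq> {complement a, complement b}" by auto
    then have "D = C" using MU_antichain[OF in_MU D(1) C(1)] comp by blast
    then have "l = complement a \<or> l = complement b" using D(2) C(2) by blast
    then show False using five_lits_iff[OF five_lits_var[OF a(1)]] five_lits_iff[OF five_lits_var[OF b(1)]] a b l by auto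
  qed
  then have ab: "flip {a, b} \<in> F" using flip_cases[of "{a, b}"] a b by blast
  have "card {l, a, b} < 4" by (simp add: card_insert_if)
  then obtain c where c: "c \<in> five_lits" "c \<notin> {l, a, b}" using two[of "{l, a, b}"] by auto
  \<comment> \<open>\<open>l\<close> and \<open>c\<close> would share the four clauses
    \<open>flip N\<close> with \<open>N \<subseteq> {a, b}\<close>.\<close>
  have "card {{}, {a}, {b}, {a, b}} \<le> 3"
    using l c a b al bl PF five_lits_flip flip1 ab by (intro card_le[of l c]) auto
  moreover have "card {{}, {a}, {b}, {a, b}} = 4" using b(3) by (auto simp: card_insert_if doubleton_eq_iff)
  ultimately show False by simp
qed

end

text \<open>Unit propagation keeps the deficiency and the remaining degrees, so induction on the
  variables reduces to the case without unit clauses.\<close>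

lemma MU6_degree:
  assumes "F \<in> MU" "deficiency F = 6"
  shows "\<exists>v\<in>cs_vars F. var_degree F v \<le> 8"
proof (rule ccontr)
  assume "\<not> ?thesis"
  then have "\<forall>v\<in>cs_vars F. 9 \<le> var_degree F v" by fastforce
  with assms show False
  proof (induction "card (cs_vars F)" arbitrary: F rule: less_induct)
    case less
    note F = less.prems(1)
    show False
    proof (cases "\<exists>l. {l} \<in> F")
      case True
      then obtain l where l: "{l} \<in> F" ..
      note u = unit_propagation[OF F l]
      have lv: "lit_var l \<in> cs_vars F" using in_cs_vars[OF l] by simp
      have "card (cs_vars (assign F l)) < card (cs_vars F)"
        unfolding u(2) using finite_cs_vars[OF MU_clause_set[OF F]] lv by (rule card_Diff1_less)
      moreover have "\<forall>v\<in>cs_vars (assign F l). 9 \<le> var_degree (assign F l) v"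
        using u(2,6) less.prems(3) by auto
      ultimately show False using less.hyps u(1,4) less.prems(2) by auto
    next
      case False
      obtain F' where F': "saturated F'" "extends F F'" using saturation_exists F by blast
      have M: "F' \<in> MU" using F' saturated_MU by blast
      interpret saturated_def6 F'
      proof
        show "saturated F'" by (rule F')
        show "deficiency F' = 6" using extends_deficiency[OF F'(2)] less.prems(2) by simp
        show "9 \<le> var_degree F' v" if "v \<in> cs_vars F'" for v
          using less.prems(3) that extends_cs_vars[OF F'(2)]
            extends_var_degree_le[OF F'(2) MU_finite[OF M], of v] by fastforce
        show "{m} \<notin> F'" for m
        proof
          assume "{m} \<in> F'"
          then obtain C where C: "C \<in> F" "C \<subseteq> {m}" by (rule extends_supersetE[OF F'(2)])
          then have "C = {}" using False by (metis subset_singletonD)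
          then have "F = {{}}" using MU_empty_clause F C by blast
          then show False
            using less.prems(2) by (simp add: deficiency_empty_clause)
        qed
      qed
      show False by (rule contradiction)
    qed
  qed
qed


section \<open>The upper bound\<close>

text \<open>A counterexample for \<open>n + 1\<close> splits its degree
  \<open>2 ^ (n + 1) + 1\<close> into \<open>a > b\<close>. If \<open>b = 2 ^ n\<close>, setting the
  rarer literal gives a counterexample for \<open>n\<close>. If \<open>b < 2 ^ n\<close>, setting
  the other one leaves deficiency \<open>b - n\<close> and degrees at least \<open>b\<close>, where
  the degree bound holds with \<open>q = n - 1\<close>.\<close>

lemma MU_degree_exceptional:
  assumes "3 \<le> n" "F \<in> MU" "deficiency F = 2 ^ n - int n + 1"
  shows "\<exists>v\<in>cs_vars F. var_degree F v \<le> 2 ^ n"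
  using assms
proof (induction n arbitrary: F rule: dec_induct)
  case base
  then show ?case using MU6_degree[of F] by auto
next
  case (step n)
  show ?case
  proof (rule ccontr)
    assume "\<not> ?thesis"
    then have deg: "2 ^ Suc n + 1 \<le> var_degree F v" if "v \<in> cs_vars F" for v using that by fastforce
    note F = step.prems(1)
    have n1: "int n < 2 ^ n" by (simp add: of_nat_less_two_power)
    have ne: "cs_vars F \<noteq> {}"
    proof
      assume "cs_vars F = {}"
      then have "F = {{}}" using MU_no_vars F by blast
      then have "deficiency F = 1" by (simp add: deficiency_empty_clause)
      then show False using step.prems(2) n1 by simp
    qed
    obtain F' where F': "saturated F'" "extends F F'" using saturation_exists F by blast
    have M: "F' \<in> MU" using F' saturated_MU by blast
    have vs: "cs_vars F' = cs_vars F" using F' extends_cs_vars by blast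
    have df: "deficiency F' = 2 ^ Suc n - int n" using extends_deficiency[OF F'(2)] step.prems(2) by simp
    have deg': "2 ^ Suc n + 1 \<le> var_degree F' v" if "v \<in> cs_vars F'" for v
      using deg[of v] extends_var_degree_le[OF F'(2) MU_finite[OF M], of v] that vs by simp
    obtain l where l: "lit_var l \<in> cs_vars F'"
      "\<And>w. w \<in> cs_vars F' \<Longrightarrow> var_degree F' (lit_var l) \<le> var_degree F' w"
      "ld F' (complement l) \<le> ld F' l"
      using saturated_min_literal[OF F'(1)] ne vs by metis
    have l': "lit_var (complement l) \<in> cs_vars F'"
      "\<And>w. w \<in> cs_vars F' \<Longrightarrow> var_degree F' (lit_var (complement l)) \<le> var_degree F' w"
      using l by simp_all
    note s = split_min_degree[OF F'(1) l(1,2)] and s' = split_min_degree[OF F'(1) l']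
    define a b where "a = ld F' l" and "b = ld F' (complement l)"
    have ab: "2 ^ Suc n + 1 \<le> a + b" "b \<le> a" using deg'[OF l(1)] s(4) l(3) by (simp_all add: a_def b_def)
    have ab': "a + b = 2 ^ Suc n + 1"
    proof (rule ccontr)
      assume "a + b \<noteq> 2 ^ Suc n + 1"
      then have "2 ^ Suc n + 2 \<le> var_degree F' w" if "w \<in> cs_vars F'" for w
        using ab(1) l(2)[OF that] s(4) by (simp add: a_def b_def)
      moreover have "(2 ^ Suc n + 2 :: nat) < 2 ^ Suc (Suc n)"
        using power_increasing[of 3 n "2::nat"] step.hyps by simp
      \<comment> \<open>A larger minimum degree would need one more than the deficiency
        available.\<close>
      ultimately have "int (2 ^ Suc n + 2) \<le> deficiency F' + int (Suc n)"
        using ne vs by (intro MU_degree_bound[OF M]) auto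
      then show False using df by simp
    qed
    have degl: "2 ^ Suc n + 1 - a \<le> var_degree (assign F' l) w" if "w \<in> cs_vars (assign F' l)" for w
      using var_degree_assign_ge[OF M, of w l] deg'[of w] that s(2) by (auto simp: a_def)
    have degl': "2 ^ Suc n + 1 - b \<le> var_degree (assign F' (complement l)) w"
      if "w \<in> cs_vars (assign F' (complement l))" for w
      using var_degree_assign_ge[OF M, of w "complement l"] deg'[of w] that s'(2) by (auto simp: b_def)
    have ale: "int a \<le> 2 ^ Suc n - int n"
      using MU_deficiency_pos[OF s(1)] s(3) df by (simp add: a_def)
    have abi: "int a + int b = 2 ^ Suc n + 1" using arg_cong[OF ab', of int] by simp
    \<comment> \<open>Since \<open>a\<close> is at most the deficiency,
      \<open>b \<ge> n + 1\<close>; this guarantees variables after setting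
      \<open>l\<close>.\<close>
    then have b2: "2 \<le> b" using ale step.hyps(1) by linarith
    show False
    proof (cases "a = 2 ^ n + 1")
      case True
      then have "b = 2 ^ n" using ab' by simp
      then have "deficiency (assign F' (complement l)) = 2 ^ n - int n + 1"
        using s'(3) df by (simp add: b_def)
      then obtain v where "v \<in> cs_vars (assign F' (complement l))" "var_degree (assign F' (complement l)) v \<le> 2 ^ n"
        using step.IH[OF s'(1)] by blast
      then show False using degl'[of v] \<open>b = 2 ^ n\<close> by simp
    next
      case False
      then have b: "b < 2 ^ n" using ab ab' by simp
      have "b \<le> var_degree (assign F' l) w" if "w \<in> cs_vars (assign F' l)" for w
        using degl[OF that] ab' by simp
      moreover have "b < 2 ^ Suc (n - 1)" using b step.hyps by simp
      moreover have "cs_vars (assign F' l) \<noteq> {}"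
        using assign_cs_vars_ne[OF M s(1)] b2 by (simp add: b_def)
      ultimately have "int b \<le> deficiency (assign F' l) + int (n - 1)"
        by (intro MU_degree_bound[OF s(1)])
      then show False using abi s(3) df step.hyps(1) by (simp add: a_def)
    qed
  qed
qed

section \<open>The sequence \<open>nM\<close>\<close>

definition non_mersenne :: "nat set" where
  "non_mersenne = {m. m \<ge> 1 \<and> \<not> (\<exists>n\<ge>1. m = 2 ^ n - 1)}"

lemma non_mersenneI:
  assumes "1 \<le> q" "2 ^ q \<le> m" "m + 1 < 2 ^ Suc q"
  shows "m \<in> non_mersenne"
proof -
  have "False" if "m = 2 ^ n - 1" for n :: nat
  proof -
    have "m + 1 = 2 ^ n" using that by simp
    then have less: "(2::nat) ^ q < 2 ^ n" "(2::nat) ^ n < 2 ^ Suc q" using assms(2,3) by linarith+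
    have "q < n" by (rule power_less_imp_less_exp[OF _ less(1)]) simp
    moreover have "n < Suc q" by (rule power_less_imp_less_exp[OF _ less(2)]) simp
    ultimately show False by simp
  qed
  moreover have "1 \<le> m" using assms(2) by (meson le_trans one_le_numeral one_le_power)
  ultimately show ?thesis by (auto simp: non_mersenne_def)
qed

lemma infinite_non_mersenne: "infinite non_mersenne"
  unfolding infinite_nat_iff_unbounded
proof
  fix m
  have "m < 2 ^ Suc m" using less_exp[of "Suc m"] by simp
  moreover have "(2::nat) ^ Suc m \<in> non_mersenne"
    by (rule non_mersenneI[of "Suc m"]) (use less_exp[of "Suc m"] in auto)
  ultimately show "\<exists>n>m. n \<in> non_mersenne" by blast
qed

text \<open>Up to a value in the range of \<open>q\<close>, exactly the \<open>q\<close> numbers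
  \<open>2 ^ i - 1\<close> with \<open>1 \<le> i \<le> q\<close> have been skipped; the extra 1 is
  due to counting from 0.\<close>

lemma enumerate_non_mersenne:
  "\<exists>q\<ge>1. 2 ^ q \<le> enumerate non_mersenne j \<and> enumerate non_mersenne j + 1 < 2 ^ Suc q \<and>
     enumerate non_mersenne j = j + 1 + q"
proof (induction j)
  case 0
  have "enumerate non_mersenne 0 = 2"
    unfolding enumerate_0
  proof (rule Least_equality)
    show "(2::nat) \<in> non_mersenne" by (rule non_mersenneI[of 1]) auto
    fix y :: nat assume "y \<in> non_mersenne"
    then have "1 \<le> y" "y \<noteq> 2 ^ 1 - 1" unfolding non_mersenne_def by blast+
    then show "2 \<le> y" by simp
  qed
  then show ?case by (intro exI[of _ 1]) simp
next
  case (Suc j)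
  define e where "e = enumerate non_mersenne j"
  obtain q where q: "1 \<le> q" "2 ^ q \<le> e" "e + 1 < 2 ^ Suc q" "e = j + 1 + q"
    using Suc by (auto simp: e_def)
  have en: "enumerate non_mersenne (Suc j) = (LEAST s. s \<in> non_mersenne \<and> e < s)"
    unfolding e_def by (rule enumerate_Suc''[OF infinite_non_mersenne])
  show ?case
  proof (cases "e + 2 = 2 ^ Suc q")
    case False
    have "(LEAST s. s \<in> non_mersenne \<and> e < s) = e + 1"
    proof (rule Least_equality)
      show "e + 1 \<in> non_mersenne \<and> e < e + 1"
        using q False by (auto intro!: non_mersenneI[of q])
    qed auto
    then show ?thesis using en q False by (intro exI[of _ q]) auto
  next
    case True
    have "(4::nat) \<le> 2 ^ Suc q" using power_increasing[of 2 "Suc q" "2::nat"] q(1) by simp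
    have "(LEAST s. s \<in> non_mersenne \<and> e < s) = e + 2"
    proof (rule Least_equality)
      show "e + 2 \<in> non_mersenne \<and> e < e + 2"
        using q True \<open>4 \<le> 2 ^ Suc q\<close> by (auto intro!: non_mersenneI[of "Suc q"])
      fix y assume y: "y \<in> non_mersenne \<and> e < y"
      have "e + 1 = 2 ^ Suc q - 1" using True by simp
      then have "e + 1 \<notin> non_mersenne" unfolding non_mersenne_def using le_add1[of 1 q] by auto
      then show "e + 2 \<le> y" using y by (cases "y = e + 1") auto
    qed
    then show ?thesis using en q True \<open>4 \<le> 2 ^ Suc q\<close> by (intro exI[of _ "Suc q"]) auto
  qed
qed

text \<open>The form that the degree bound needs: \<open>nM k + 1\<close> still has binary logarithm
  \<open>q\<close>, so this minimum degree would need deficiency \<open>k + 1\<close>.\<close>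

lemma nM_bounds:
  assumes "1 \<le> k"
  shows "\<exists>q\<ge>1. 2 ^ q \<le> nM k \<and> nM k + 1 < 2 ^ Suc q \<and> nM k = k + q"
proof -
  have "nM k = enumerate non_mersenne (k - 1)" by (simp only: nM_def non_mersenne_def)
  then show ?thesis using enumerate_non_mersenne[of "k - 1"] assms by simp
qed

text \<open>With \<open>q = n - 1\<close> the value would be \<open>2 ^ n\<close>, outside its
  range, and for smaller \<open>q\<close> already \<open>k\<close> is too large; so
  \<open>q \<ge> n\<close>.\<close>

lemma nM_exceptional:
  assumes n: "3 \<le> n" and k: "k = 2 ^ n - n + 1"
  shows "2 ^ n + 1 \<le> nM k"
proof -
  obtain q where q: "nM k + 1 < 2 ^ Suc q" "nM k = k + q" using nM_bounds[of k] k by auto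
  have half: "n \<le> 2 ^ (n - 1)" using less_exp[of "n - 1"] n by linarith
  have two: "(2::nat) ^ n = 2 * 2 ^ (n - 1)" using n by (cases n) auto
  have "n \<le> q"
  proof (rule ccontr)
    assume "\<not> n \<le> q"
    then consider "Suc q = n" | "Suc q \<le> n - 1" by linarith
    then show False
    proof cases
      case 1
      then show ?thesis using q k half two by simp
    next
      case 2
      then have "(2::nat) ^ Suc q \<le> 2 ^ (n - 1)" by (rule power_increasing) simp
      then show ?thesis using q k half two by linarith
    qed
  qed
  then show ?thesis using q(2) k half two by linarith
qed

lemma MU_vars_ne:
  assumes "F \<in> MU" "F \<noteq> {{}}"
  shows "cs_vars F \<noteq> {}"
  using MU_no_vars assms by blast

theorem MU_min_var_degree_le:
  assumes k: "1 \<le> k" and F: "F \<in> MU" "deficiency F = int k" "F \<noteq> {{}}"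
  shows "min_var_degree F \<le> nM1 k"
proof -
  have ne: "cs_vars F \<noteq> {}" by (rule MU_vars_ne[OF F(1,3)])
  have "\<exists>v\<in>cs_vars F. var_degree F v \<le> nM1 k"
  proof (cases "\<exists>n\<ge>3. k = 2 ^ n - n + 1")
    case True
    then obtain n where n: "3 \<le> n" "k = 2 ^ n - n + 1" by blast
    have "n \<le> 2 ^ n" using less_exp[of n] by simp
    then have "deficiency F = 2 ^ n - int n + 1" using F(2) n(2) by (simp add: of_nat_diff)
    then obtain v where "v \<in> cs_vars F" "var_degree F v \<le> 2 ^ n"
      using MU_degree_exceptional[OF n(1) F(1)] by blast
    moreover have "nM1 k = nM k - 1" unfolding nM1_def using True by (rule if_P)
    then have "2 ^ n \<le> nM1 k" using nM_exceptional[OF n] by simp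
    ultimately show ?thesis by (meson le_trans)
  next
    case False
    obtain q where q: "nM k + 1 < 2 ^ Suc q" "nM k = k + q" using nM_bounds[OF k] by blast
    have "\<exists>v\<in>cs_vars F. var_degree F v \<le> nM k"
    proof (rule ccontr)
      assume "\<not> ?thesis"
      then have "nM k + 1 \<le> var_degree F v" if "v \<in> cs_vars F" for v using that by fastforce
      then have "int (nM k + 1) \<le> deficiency F + int q"
        by (rule MU_degree_bound[OF F(1) ne _ q(1)])
      then show False using q(2) F(2) by simp
    qed
    moreover have "nM1 k = nM k" unfolding nM1_def using False by (rule if_not_P)
    ultimately show ?thesis by simp
  qed
  then obtain v where v: "v \<in> cs_vars F" "var_degree F v \<le> nM1 k" by blast
  have "min_var_degree F \<le> var_degree F v"
    unfolding min_var_degree_def using v(1) finite_cs_vars[OF MU_clause_set[OF F(1)]] by (intro Min_le) auto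
  then show ?thesis using v(2) by simp
qed

lemma fc_le_min_var_degree:
  assumes F: "F \<in> MU" "F \<noteq> {{}}"
  shows "fc F \<le> min_var_degree F"
proof -
  have fin: "finite (cs_vars F)" using finite_cs_vars[OF MU_clause_set[OF F(1)]] .
  have "fc F \<le> var_degree F v" if "v \<in> cs_vars F" for v
    unfolding fc_def var_degree_def using that MU_finite[OF F(1)] by (intro card_mono) auto
  then show ?thesis
    unfolding min_var_degree_def using fin MU_vars_ne[OF F] by (subst Min_ge_iff) auto
qed

section \<open>The lower bound\<close>

text \<open>The assignment falsifying \<open>C\<close> satisfies every clause that clashes with
  \<open>C\<close>.\<close>

lemma UHIT_subset_MU: "UHIT \<subseteq> MU"
proof
  fix F :: "'v literal set set" assume F: "F \<in> UHIT"
  then have cs: "is_clause_set F" and hit: "\<And>C D. C \<in> F \<Longrightarrow> D \<in> F \<Longrightarrow> C \<noteq> D \<Longrightarrow> \<exists>x\<in>C. complement x \<in> D"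
    by (auto simp: UHIT_def)
  show "F \<in> MU"
    unfolding MU_iff
  proof (intro conjI ballI)
    show "is_clause_set F" by (rule cs)
    show "\<forall>\<phi>. \<not> models \<phi> F" using F satisfiable_iff_models[OF cs] by (auto simp: UHIT_def)
    fix C assume C: "C \<in> F"
    let ?\<phi> = "\<lambda>v. Neg v \<in> C"
    have "\<exists>x\<in>D. lit_true ?\<phi> x" if D: "D \<in> F - {C}" for D
    proof -
      have "\<exists>x\<in>C. complement x \<in> D" using D by (intro hit[OF C]) auto
      then obtain x where x: "x \<in> C" "complement x \<in> D" by blast
      then have "lit_true ?\<phi> (complement x)"
        using clause_setD(3)[OF cs C x(1)] by (cases x) auto
      then show ?thesis using x by blast
    qed
    then show "\<exists>\<phi>. models \<phi> (F - {C})" unfolding models_def by blast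
  qed
qed

lemma UHIT_extend_full:
  fixes F :: "'v::infinite literal set set"
  assumes F: "F \<in> UHIT" and h: "1 \<le> h" "h \<le> fc F"
  shows "\<exists>E :: 'v literal set set. E \<in> UHIT \<and> deficiency E = deficiency F + int h - 1 \<and>
    2 * h \<le> fc E \<and> E \<noteq> {{}}"
proof -
  have M: "F \<in> MU" using F UHIT_subset_MU by blast
  have cs: "is_clause_set F" by (rule MU_clause_set[OF M])
  have finF: "finite F" by (rule MU_finite[OF M])
  have hit: "\<And>C D. C \<in> F \<Longrightarrow> D \<in> F \<Longrightarrow> C \<noteq> D \<Longrightarrow> \<exists>x\<in>C. complement x \<in> D"
    using F by (auto simp: UHIT_def)
  obtain A where A: "A \<subseteq> {C \<in> F. clause_vars C = cs_vars F}" "card A = h"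
    using obtain_subset_with_card_n[OF h(2)[unfolded fc_def]] by blast
  have AF: "A \<subseteq> F" using A by blast
  have finA: "finite A" using AF finF by (rule finite_subset)
  obtain v where v: "v \<notin> cs_vars F"
    using ex_new_if_finite[OF infinite_UNIV finite_cs_vars[OF cs]] by blast
  have fresh: "Pos v \<notin> C" "Neg v \<notin> C" if "C \<in> F" for C
    using in_cs_vars[OF that] v by fastforce+
  define P N where "P = insert (Pos v) ` A" and "N = insert (Neg v) ` A"
  define E where "E = (F - A) \<union> P \<union> N"
  have inj: "inj_on (insert x) A" if "x = Pos v \<or> x = Neg v" for x
  proof (rule inj_onI)
    fix C D assume "C \<in> A" "D \<in> A" and e: "insert x C = insert x D"
    then have "x \<notin> C" "x \<notin> D" using fresh AF that by blast+
    then show "C = D" using e by (simp add: insert_ident)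
  qed
  have disj: "(F - A) \<inter> P = {}" "((F - A) \<union> P) \<inter> N = {}"
  proof -
    have "Pos v \<notin> X" "Neg v \<notin> X" if "X \<in> F - A" for X using fresh that by blast+
    moreover have "Pos v \<in> X" "Neg v \<notin> X" if "X \<in> P" for X using that fresh AF by (auto simp: P_def)
    moreover have "Neg v \<in> X" if "X \<in> N" for X using that by (auto simp: N_def)
    ultimately show "(F - A) \<inter> P = {}" "((F - A) \<union> P) \<inter> N = {}" by blast+
  qed
  have cardPN: "card P = h" "card N = h"
    unfolding P_def N_def using card_image[OF inj] A(2) by simp_all
  have "card E = card (F - A) + card P + card N"
    unfolding E_def using disj finF finA by (simp add: card_Un_disjoint P_def N_def)
  then have cardE: "card E = card F + h"
    using cardPN card_Diff_subset[OF finA AF] card_mono[OF finF AF] A(2) by simp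
  have csE: "is_clause_set E"
    unfolding is_clause_set_def
  proof
    show "finite E" using finF finA by (simp add: E_def P_def N_def)
    have "is_clause (insert x C)" if "C \<in> A" "x = Pos v \<or> x = Neg v" for x C
      using that fresh[of C] AF cs by (auto simp: is_clause_set_def is_clause_def elim: complement.elims)
    then show "\<forall>C\<in>E. is_clause C"
      using cs by (auto simp: E_def P_def N_def is_clause_set_def)
  qed
  have "\<not> models \<phi> E" for \<phi>
  proof
    assume m: "models \<phi> E"
    have "\<exists>x\<in>C. lit_true \<phi> x" if C: "C \<in> F" for C
    proof (cases "C \<in> A")
      case True
      then have "insert (Pos v) C \<in> E" "insert (Neg v) C \<in> E" by (auto simp: E_def P_def N_def)
      then show ?thesis using m unfolding models_def by (metis insert_iff lit_true.simps)
    next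
      case False
      then show ?thesis using m C unfolding models_def E_def by blast
    qed
    then show False using MU_unsat[OF M, of \<phi>] by (simp add: models_def)
  qed
  moreover have "\<exists>x\<in>C. complement x \<in> D" if CD: "C \<in> E" "D \<in> E" "C \<noteq> D" for C D
  proof -
    \<comment> \<open>Clauses of \<open>E\<close> from different clauses of \<open>F\<close> clash
      as these do; clauses with the same origin clash on \<open>v\<close>.\<close>
    have base: "\<exists>B\<in>F. B \<subseteq> X \<and> (X = B \<and> B \<notin> A \<or> X = insert (Pos v) B \<and> B \<in> A \<or> X = insert (Neg v) B \<and> B \<in> A)"
      if "X \<in> E" for X
      using that AF unfolding E_def P_def N_def by blast
    obtain B where B: "B \<in> F" "B \<subseteq> C" "C = B \<and> B \<notin> A \<or> C = insert (Pos v) B \<and> B \<in> A \<or> C = insert (Neg v) B \<and> B \<in> A"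
      using base[OF CD(1)] by blast
    obtain B' where B': "B' \<in> F" "B' \<subseteq> D" "D = B' \<and> B' \<notin> A \<or> D = insert (Pos v) B' \<and> B' \<in> A \<or> D = insert (Neg v) B' \<and> B' \<in> A"
      using base[OF CD(2)] by blast
    show ?thesis
    proof (cases "B = B'")
      case True
      then have "C = insert (Pos v) B \<and> D = insert (Neg v) B \<or> C = insert (Neg v) B \<and> D = insert (Pos v) B"
        using B(3) B'(3) CD(3) by auto
      then show ?thesis by auto
    next
      case False
      then show ?thesis using hit B(1,2) B'(1,2) by blast
    qed
  qed
  ultimately have EU: "E \<in> UHIT"
    using csE satisfiable_iff_models[OF csE] by (auto simp: UHIT_def)
  have "A \<noteq> {}" using A(2) h(1) by auto
  then have "cs_vars P = insert v (cs_vars A)" "cs_vars N = insert v (cs_vars A)"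
    by (auto simp: P_def N_def cs_vars_def clause_vars_def)
  moreover have "cs_vars (F - A) \<union> cs_vars A = cs_vars F" using AF by (auto simp: cs_vars_def)
  moreover have "cs_vars E = cs_vars (F - A) \<union> cs_vars P \<union> cs_vars N" by (simp add: E_def cs_vars_def)
  ultimately have vars: "cs_vars E = insert v (cs_vars F)" by blast
  have "card (cs_vars E) = Suc (card (cs_vars F))"
    unfolding vars using v finite_cs_vars[OF cs] by simp
  then have "deficiency E = deficiency F + int h - 1"
    using cardE by (simp add: deficiency_def num_clauses_def num_vars_def)
  moreover have "2 * h \<le> fc E"
  proof -
    have "P \<union> N \<subseteq> {C \<in> E. clause_vars C = cs_vars E}"
      using A(1) vars unfolding E_def P_def N_def by (auto simp: clause_vars_def)
    moreover have "card (P \<union> N) = 2 * h"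
      using disj finA cardPN by (subst card_Un_disjoint) (auto simp: P_def N_def)
    moreover have "finite {C \<in> E. clause_vars C = cs_vars E}" using csE by (simp add: is_clause_set_def)
    ultimately show ?thesis
      unfolding fc_def using card_mono[of "{C \<in> E. clause_vars C = cs_vars E}" "P \<union> N"] by linarith
  qed
  moreover have "E \<noteq> {{}}" using vars by (auto simp: cs_vars_def clause_vars_def)
  ultimately show ?thesis using EU by blast
qed

section \<open>The recursion of \<open>S2\<close>\<close>

lemma two_power_fact_dvd: "(2::nat) ^ h * fact h dvd fact (2 * h)"
proof (induction h)
  case (Suc h)
  have "(2::nat) ^ Suc h * fact (Suc h) = (2 * h + 2) * (2 ^ h * fact h)" by (simp add: algebra_simps)
  also have "\<dots> dvd (2 * h + 2) * ((2 * h + 1) * fact (2 * h))"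
    by (intro mult_dvd_mono dvd_refl dvd_mult Suc)
  also have "\<dots> = fact (2 * Suc h)" by (simp add: algebra_simps)
  finally show ?case .
qed simp

text \<open>For the least \<open>h\<close> with \<open>2 ^ k\<close> dividing
  \<open>2 ^ h * fact h\<close>, doubling \<open>h\<close> full clauses gives at least
  \<open>S2 k\<close> of them. Minimality of \<open>h\<close> ensures that the clause-set for
  \<open>k - h + 1\<close> has \<open>h\<close> full clauses.\<close>

lemma UHIT_full_clauses:
  assumes "1 \<le> k"
  shows "\<exists>E :: 'v::infinite literal set set. E \<in> UHIT \<and> deficiency E = int k \<and> S2 k \<le> fc E \<and> E \<noteq> {{}}"
  using assms
proof (induction k rule: less_induct)
  case (less k)
  define Q where "Q h \<longleftrightarrow> (2::nat) ^ k dvd 2 ^ h * fact h" for h :: nat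
  define h where "h = (LEAST h. Q h)"
  have "Q k" by (simp add: Q_def)
  then have Qh: "Q h" and hk: "h \<le> k" unfolding h_def by (auto intro: LeastI Least_le)
  have "(2::nat) ^ k \<noteq> 1" using less.prems by simp
  then have h1: "1 \<le> h" using Qh by (cases h) (auto simp: Q_def)
  have notQ: "\<not> Q (h - 1)" using not_less_Least[of "h - 1" Q] h1 by (simp add: h_def)
  have S2: "S2 k \<le> 2 * h"
    unfolding S2_def using Qh two_power_fact_dvd[of h] by (intro Least_le) (auto simp: Q_def intro: dvd_trans)
  have "\<exists>F :: 'v literal set set. F \<in> UHIT \<and> deficiency F = int (k - h + 1) \<and> h \<le> fc F"
  proof (cases "h = 1")
    case True
    then have "(2::nat) ^ k dvd 2 ^ 1" using Qh by (simp add: Q_def)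
    then have "k \<le> 1" by (metis dvd_power_iff_le order_refl)
    then have "k = 1" using less.prems by simp
    have "{{}} \<in> (UHIT :: 'v literal set set set)"
      by (auto simp: UHIT_def is_clause_set_def is_clause_def satisfiable_def)
    moreover have "deficiency {{} :: 'v literal set} = 1" "fc {{} :: 'v literal set} = 1"
      by (simp_all add: deficiency_def num_clauses_def num_vars_def fc_def cs_vars_def clause_vars_def)
    ultimately show ?thesis using True \<open>k = 1\<close> by (intro exI[of _ "{{}}"]) simp
  next
    case False
    then have "k - h + 1 < k" using h1 hk by linarith
    then obtain F :: "'v literal set set" where F: "F \<in> UHIT" "deficiency F = int (k - h + 1)" "S2 (k - h + 1) \<le> fc F"
      using less.IH[of "k - h + 1"] by auto
    \<comment> \<open>Otherwise \<open>2 ^ (k - h + 1)\<close> divides \<open>fact (h - 1)\<close>,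
      so that \<open>h - 1\<close> would already satisfy \<open>Q\<close>.\<close>
    have "h \<le> S2 (k - h + 1)"
    proof (rule ccontr)
      assume "\<not> ?thesis"
      then have lt: "S2 (k - h + 1) \<le> h - 1" by simp
      have "(2::nat) ^ (k - h + 1) dvd fact (2 * (k - h + 1))"
        using two_power_fact_dvd[of "k - h + 1"] by (metis dvd_mult_left)
      then have "(2::nat) ^ (k - h + 1) dvd fact (S2 (k - h + 1))" unfolding S2_def by (rule LeastI)
      also have "\<dots> dvd (fact (h - 1) :: nat)" using lt by (rule fact_dvd)
      finally have "2 ^ (h - 1) * 2 ^ (k - h + 1) dvd 2 ^ (h - 1) * (fact (h - 1) :: nat)" by simp
      moreover have "h - 1 + (k - h + 1) = k" using h1 hk by simp
      ultimately have "Q (h - 1)" unfolding Q_def by (metis power_add)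
      then show False using notQ by simp
    qed
    then show ?thesis using F by (intro exI[of _ F]) simp
  qed
  then obtain F :: "'v literal set set" where F: "F \<in> UHIT" "deficiency F = int (k - h + 1)" "h \<le> fc F" by blast
  obtain E :: "'v literal set set" where E: "E \<in> UHIT" "deficiency E = deficiency F + int h - 1" "2 * h \<le> fc E" "E \<noteq> {{}}"
    using UHIT_extend_full[OF F(1) h1 F(3)] by blast
  have "deficiency E = int k" using E(2) F(2) hk by simp
  then show ?case using E S2 by (intro exI[of _ E]) simp
qed

theorem theorem6p4:
  fixes k :: nat
  assumes "k \<ge> 1"
    and "S2 k = nM1 k"
  shows "S2 k = FCH TYPE('v::infinite) k \<and>
         FCH TYPE('v) k = FCM TYPE('v) k \<and>
         FCM TYPE('v) k = VDH TYPE('v) k \<and>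
         VDH TYPE('v) k = VDM TYPE('v) k \<and>
         VDM TYPE('v) k = nM1 k"
proof -
  obtain E :: "'v literal set set" where E: "E \<in> UHIT" "deficiency E = int k" "S2 k \<le> fc E" "E \<noteq> {{}}"
    using UHIT_full_clauses[OF assms(1)] by blast
  have EM: "E \<in> MU" using E UHIT_subset_MU by blast
  have up: "min_var_degree F \<le> S2 k" if "F \<in> MU" "deficiency F = int k" "F \<noteq> {{}}" for F :: "'v literal set set"
    using MU_min_var_degree_le[OF assms(1) that] assms(2) by simp
  have Efc: "fc E \<le> min_var_degree E" by (rule fc_le_min_var_degree[OF EM E(4)])
  \<comment> \<open>The chain \<open>S2 k \<le> fc E \<le> min_var_degree E \<le> S2 k\<close>
    closes, so the single clause-set \<open>E\<close> attains all four maxima.\<close>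
  then have fcE: "fc E = S2 k" and mdE: "min_var_degree E = S2 k" using up[OF EM E(2,4)] E(3) by auto
  \<comment> \<open>\<open>{{}}\<close> has one full clause but no min-var-degree, so bounding its
    \<open>fc\<close> takes this separate fact.\<close>
  have pos: "1 \<le> S2 k"
    using nM_bounds[OF assms(1)] assms fcE E(3) by (auto simp: nM1_def)
  have upfc: "fc F \<le> S2 k" if "F \<in> MU" "deficiency F = int k" for F :: "'v literal set set"
  proof (cases "F = {{}}")
    case True
    then show ?thesis using pos by (simp add: fc_def cs_vars_def clause_vars_def)
  next
    case False
    then show ?thesis using fc_le_min_var_degree[OF that(1)] up[OF that] by simp
  qed
  \<comment> \<open>The upper bound also makes the set finite, so \<open>Max\<close> is a genuine
    maximum.\<close>
  have Max_S2: "Max X = S2 k" if "\<And>x. x \<in> X \<Longrightarrow> x \<le> S2 k" "S2 k \<in> X" for X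
    using that by (intro Max_eqI finite_subset[of X "{..S2 k}"]) auto
  have "FCH TYPE('v) k = S2 k"
    unfolding FCH_def
    by (rule Max_S2) (use upfc UHIT_subset_MU E(1,2) fcE[symmetric] in blast)+
  moreover have "FCM TYPE('v) k = S2 k"
    unfolding FCM_def
    by (rule Max_S2) (use upfc EM E(2) fcE[symmetric] in blast)+
  moreover have "VDH TYPE('v) k = S2 k"
    unfolding VDH_def
    by (rule Max_S2) (use up UHIT_subset_MU E(1,2,4) mdE[symmetric] in blast)+
  moreover have "VDM TYPE('v) k = S2 k"
    unfolding VDM_def
    by (rule Max_S2) (use up EM E(2,4) mdE[symmetric] in blast)+
  ultimately show ?thesis using assms(2) by simp
qed

end
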